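(* Let $\beta=1-\delta$ where $\delta=\delta(n)>0$ satisfies $\delta^2n\to\infty$. Then the normalized magnetization chain $(S_t)$ of the Glauber dynamics for the mean-field Ising model on $n$ vertices exhibits cutoff at time $\frac12\cdot\frac n\delta\log(\delta^2n)$ with a window of order $n/\delta$; that is, $$\lim_{\gamma\to\infty}\limsup_{n\to\infty} d_n\Big(\tfrac12\tfrac n\delta\log(\delta^2n)+\gamma\tfrac n\delta\Big)=0\quad\text{and}\quad \lim_{\gamma\to\infty}\liminf_{n\to\infty} d_n\Big(\tfrac12\tfrac n\delta\log(\delta^2n)-\gamma\tfrac n\delta\Big)=1,$$ where $d_n(t)=\max_{s_0}\|\mathbb{P}_{s_0}(S_t\in\cdot)-\pi_n\|_{\mathrm{TV}}$.
   Context: For $n\ge1$ and $\beta\ge0$, the mean-field Ising measure on $\Omega=\{1,-1\}^n$ is $\mu_n(\sigma)\propto\exp\big(\frac{\beta}{n}\sum_{x<y}\sigma(x)\sigma(y)\big)$; the heat-bath Glauber dynamics chooses a uniform vertex and resamples its spin from $\mu_n$ conditioned on the other spins. The normalized magnetization $S(\sigma)=\frac1n\sum_i\sigma(i)$ evolves as a Markov chain $S_t$ on $\{-1,-1+\frac2n,\dots,1\}$ with $P(s,s-\frac2n)=\frac{1+s}{2}\cdot\frac{1-\tanh(\beta(s-1/n))}{2}$, $P(s,s+\frac2n)=\frac{1-s}{2}\cdot\frac{1+\tanh(\beta(s+1/n))}{2}$, and remaining mass on $P(s,s)$; $\pi_n$ denotes its stationary distribution (the law of $S$ under $\mu_n$);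 the maximum in $d_n$ is over all starting states $s_0$ of the chain. *)

theory Defs
  imports Complex_Main "HOL-Library.Extended_Real"
begin

text \<open>Spin of vertex i in configuration A (A = set of vertices with spin +1),
  configurations are subsets of {0..<n}.\<close>
definition spin :: "nat set \<Rightarrow> nat \<Rightarrow> real" where
  "spin A i = (if i \<in> A then 1 else -1)"

definition ising_weight :: "nat \<Rightarrow> real \<Rightarrow> nat set \<Rightarrow> real" where
  "ising_weight n \<beta> A =
     exp (\<beta> / real n * (\<Sum>(x,y)\<in>{(x,y). x < y \<and> y < n}. spin A x * spin A y))"

definition ising_Z :: "nat \<Rightarrow> real \<Rightarrow> real" where
  "ising_Z n \<beta> = (\<Sum>A\<in>Pow {0..<n}. ising_weight n \<beta> A)"

definition ising_mu :: "nat \<Rightarrow> real \<Rightarrow> nat set \<Rightarrow> real" where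
  "ising_mu n \<beta> A = ising_weight n \<beta> A / ising_Z n \<beta>"

text \<open>Magnetization states are indexed by k \<in> {0..n} (number of plus spins);
  the normalized magnetization is S = (2k - n)/n.\<close>
definition magn :: "nat \<Rightarrow> nat \<Rightarrow> real" where
  "magn n k = (2 * real k - real n) / real n"

definition pi_n :: "nat \<Rightarrow> real \<Rightarrow> nat \<Rightarrow> real" where
  "pi_n n \<beta> k = (\<Sum>A\<in>{A. A \<subseteq> {0..<n} \<and> card A = k}. ising_mu n \<beta> A)"

definition p_down :: "nat \<Rightarrow> real \<Rightarrow> nat \<Rightarrow> real" where
  "p_down n \<beta> k = (let s = magn n k in
      (1 + s) / 2 * ((1 - tanh (\<beta> * (s - 1 / real n))) / 2))"

definition p_up :: "nat \<Rightarrow> real \<Rightarrow> nat \<Rightarrow> real" where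
  "p_up n \<beta> k = (let s = magn n k in
      (1 - s) / 2 * ((1 + tanh (\<beta> * (s + 1 / real n))) / 2))"

definition trans :: "nat \<Rightarrow> real \<Rightarrow> nat \<Rightarrow> nat \<Rightarrow> real" where
  "trans n \<beta> k j =
     (if k > n \<or> j > n then 0
      else if j + 1 = k then p_down n \<beta> k
      else if j = k + 1 then p_up n \<beta> k
      else if j = k then 1 - p_down n \<beta> k - p_up n \<beta> k
      else 0)"

fun dist_t :: "nat \<Rightarrow> real \<Rightarrow> nat \<Rightarrow> nat \<Rightarrow> nat \<Rightarrow> real" where
  "dist_t n \<beta> k0 0 j = (if j = k0 then 1 else 0)"
| "dist_t n \<beta> k0 (Suc t) j = (\<Sum>i\<in>{0..n}. dist_t n \<beta> k0 t i * trans n \<beta> i j)"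

definition tv_to_stat :: "nat \<Rightarrow> real \<Rightarrow> nat \<Rightarrow> nat \<Rightarrow> real" where
  "tv_to_stat n \<beta> k0 t = (1/2) * (\<Sum>j\<in>{0..n}. \<bar>dist_t n \<beta> k0 t j - pi_n n \<beta> j\<bar>)"

definition d_n :: "nat \<Rightarrow> real \<Rightarrow> nat \<Rightarrow> real" where
  "d_n n \<beta> t = Max ((\<lambda>k0. tv_to_stat n \<beta> k0 t) ` {0..n})"

text \<open>Real time argument: d_n at time \<lfloor>t\<rfloor> (0 for negative t).\<close>
definition d_n_real :: "nat \<Rightarrow> real \<Rightarrow> real \<Rightarrow> real" where
  "d_n_real n \<beta> t = d_n n \<beta> (nat \<lfloor>t\<rfloor>)"

end

theory Submission
  imports Defs
begin

text \<open>
  Upper bound. The second moment of \<open>S\<^sub>t\<close> satisfies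
  \<open>v' \<le> v - (2/n) (\<delta> v + c v\<^sup>2) + 4/n\<^sup>2\<close>: the quadratic term brings \<open>v\<close> down to order \<open>\<delta>\<close> in
  time \<open>O(n/\<delta>)\<close>, after which the linear term brings it to the stationary order \<open>1/(\<delta> n)\<close> in time
  \<open>(n/2\<delta>) ln (\<delta>\<^sup>2 n)\<close>. Both laws then live on an interval of \<open>O(sqrt (n/\<delta>))\<close> states, and
  the total variation distance after \<open>m\<close> further steps is controlled by a gradient estimate
  \<open>|P\<^sup>m f (k+1) - P\<^sup>m f k| = O(1/sqrt m)\<close> for \<open>|f| \<le> 1\<close>. That estimate uses no coupling: the discrete
  gradient evolves under a sub-Markov birth-death kernel \<open>Q\<close> on the edges, and the energy
  \<open>F(k)\<^sup>2 + F(k+1)\<^sup>2\<close> dissipates the squared gradient along \<open>Q\<close>.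

  Lower bound. From \<open>s\<^sub>0\<close> of order \<open>sqrt \<delta>\<close> the cubic part of the drift stays negligible, so
  \<open>E S\<^sub>t\<close> is at least half of \<open>x\<^sub>t = (1 - \<delta>/n)\<^sup>t s\<^sub>0\<close>, while both \<open>Var S\<^sub>t\<close> and the stationary variance
  are at most \<open>4/(\<delta> n)\<close>; Chebyshev separates the two laws as long as \<open>x\<^sub>t\<^sup>2\<close> is large compared to \<open>1/(\<delta> n)\<close>.
\<close>

section \<open>Bounds on the hyperbolic tangent\<close>

text \<open>Since tanh' = 1 - tanh^2, the difference of the two sides has derivative x^2 - (tanh
  x)^2, which is nonnegative because tanh x <= x.\<close>

lemma tanh_lower_cubic:
  fixes z :: real assumes "0 \<le> z" shows "z - z ^ 3 / 3 \<le> tanh z"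
proof -
  have abs_tanh_le: "tanh x \<le> x" if "0 \<le> x" for x :: real
  proof -
    have "(\<lambda>x. x - tanh x) 0 \<le> (\<lambda>x. x - tanh x) x"
      by (rule DERIV_nonneg_imp_nondecreasing[OF that])
        (auto intro!: exI derivative_eq_intros)
    then show ?thesis by simp
  qed
  have "(\<lambda>x. tanh x - (x - x ^ 3 / 3)) 0 \<le> (\<lambda>x. tanh x - (x - x ^ 3 / 3)) z"
  proof (rule DERIV_nonneg_imp_nondecreasing[OF assms])
    fix x :: real assume "0 \<le> x" "x \<le> z"
    then have "(tanh x)\<^sup>2 \<le> x\<^sup>2" by (intro power_mono abs_tanh_le) auto
    then show "\<exists>y. ((\<lambda>x. tanh x - (x - x ^ 3 / 3)) has_real_derivative y) (at x) \<and> 0 \<le> y"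
      by (intro exI[of _ "x\<^sup>2 - (tanh x)\<^sup>2"]) (auto intro!: derivative_eq_intros)
  qed
  then show ?thesis by simp
qed

text \<open>On [0,1] the lower cubic gives tanh x >= x/2, so tanh' <= 1 - x^2/4, and integration
  produces the 12. This cubic gap later becomes the quartic damping of the second moment.\<close>

lemma tanh_upper_cubic:
  fixes z :: real assumes "0 \<le> z" "z \<le> 1" shows "tanh z \<le> z - z ^ 3 / 12"
proof -
  have "(\<lambda>x. x - x ^ 3 / 12 - tanh x) 0 \<le> (\<lambda>x. x - x ^ 3 / 12 - tanh x) z"
  proof (rule DERIV_nonneg_imp_nondecreasing[OF assms(1)])
    fix x :: real assume x: "0 \<le> x" "x \<le> z"
    have "x ^ 3 \<le> x ^ 1" using x assms by (intro power_decreasing) auto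
    then have "x / 2 \<le> tanh x" using tanh_lower_cubic[OF x(1)] x by simp
    then have "(x / 2)\<^sup>2 \<le> (tanh x)\<^sup>2" using x by (intro power_mono) auto
    then show "\<exists>y. ((\<lambda>x. x - x ^ 3 / 12 - tanh x) has_real_derivative y) (at x) \<and> 0 \<le> y"
      by (intro exI[of _ "(tanh x)\<^sup>2 - (x / 2)\<^sup>2"])
        (auto intro!: derivative_eq_intros simp: power2_eq_square)
  qed
  then show ?thesis by simp
qed

lemma tanh_diff_le:
  fixes x y :: real assumes "x \<le> y" shows "tanh y - tanh x \<le> y - x"
proof -
  have "(\<lambda>x. x - tanh x) x \<le> (\<lambda>x. x - tanh x) y"
    by (rule DERIV_nonneg_imp_nondecreasing[OF assms]) (auto intro!: exI derivative_eq_intros)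
  then show ?thesis by simp
qed

text \<open>Concavity on the half-line does not suffice, since \<open>x - y\<close> may be negative.
  The addition formula turns the average into p (1 - q^2) / (1 - p^2 q^2), where the fraction is at
  most 1 because 0 <= p < 1.\<close>

lemma tanh_midpoint_le:
  fixes x y :: real assumes "0 \<le> x" shows "(tanh (x + y) + tanh (x - y)) / 2 \<le> tanh x"
proof -
  define p q where "p = tanh x" and "q = tanh y"
  have p: "0 \<le> p" "p < 1" and q: "\<bar>q\<bar> < 1"
    using assms tanh_real_lt_1[of x] tanh_real_lt_1[of y] tanh_real_gt_neg1[of y]
    by (auto simp: p_def q_def)
  have pq: "\<bar>p * q\<bar> < 1"
  proof -
    have "\<bar>p * q\<bar> \<le> \<bar>q\<bar>" using p by (simp add: abs_mult mult_left_le_one_le)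
    then show ?thesis using q by linarith
  qed
  have add: "tanh (x + y) = (p + q) / (1 + p * q)" "tanh (x - y) = (p - q) / (1 - p * q)"
    using tanh_add[of x y] tanh_add[of x "- y"] unfolding p_def q_def by simp_all
  have sq: "(p * q)\<^sup>2 \<le> q\<^sup>2" using p by (auto simp: power_mult_distrib intro!: mult_left_le_one_le power_le_one)
  have sq1: "(p * q)\<^sup>2 < 1" using pq by (simp add: abs_square_less_1)
  have ne: "1 + p * q \<noteq> 0" "1 - p * q \<noteq> 0" using pq by linarith+
  have "(p + q) / (1 + p * q) + (p - q) / (1 - p * q)
      = ((p + q) * (1 - p * q) + (p - q) * (1 + p * q)) / ((1 + p * q) * (1 - p * q))"
    using ne by (rule add_frac_eq)
  also have "\<dots> = 2 * (p * ((1 - q\<^sup>2) / (1 - (p * q)\<^sup>2)))"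
    by (simp add: algebra_simps power2_eq_square)
  also have "\<dots> \<le> 2 * (p * 1)"
    using p sq sq1 by (intro mult_left_mono) (auto simp: divide_le_eq_1)
  finally show ?thesis by (simp add: add p_def)
qed

lemma tanh_midpoint_mult_le:
  fixes x y :: real
  assumes "0 \<le> c"
  shows "x * ((tanh (c * x + y) + tanh (c * x - y)) / 2) \<le> x * tanh (c * x)"
proof (cases "0 \<le> x")
  case True
  then show ?thesis using assms by (intro mult_left_mono tanh_midpoint_le) auto
next
  case False
  then have "(tanh (- (c * x) + y) + tanh (- (c * x) - y)) / 2 \<le> tanh (- (c * x))"
    using assms by (intro tanh_midpoint_le) (simp add: mult_nonneg_nonpos)
  moreover have "tanh (- (c * x) + y) = - tanh (c * x - y)" "tanh (- (c * x) - y) = - tanh (c * x + y)"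
    by (simp_all flip: tanh_minus)
  ultimately show ?thesis using False by (intro mult_left_mono_neg) auto
qed

lemma mult_tanh_le:
  fixes z :: real
  assumes "\<bar>z\<bar> \<le> 1"
  shows "z * tanh z \<le> z\<^sup>2 - z ^ 4 / 12"
proof -
  have "\<bar>z\<bar> * tanh \<bar>z\<bar> \<le> \<bar>z\<bar> * (\<bar>z\<bar> - \<bar>z\<bar> ^ 3 / 12)"
    using assms by (intro mult_left_mono tanh_upper_cubic) auto
  also have "\<dots> = z\<^sup>2 - z ^ 4 / 12"
    by (simp add: algebra_simps power2_eq_square power4_eq_xxxx power3_eq_cube flip: abs_mult)
  finally show ?thesis by (cases "0 \<le> z") auto
qed

lemma tanh_ge_cubic:
  fixes z :: real shows "z - \<bar>z\<bar> ^ 3 / 3 \<le> tanh z"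
proof (cases "0 \<le> z")
  case True
  then show ?thesis using tanh_lower_cubic[of z] by simp
next
  case False
  then have "tanh (- z) \<le> - z" using tanh_diff_le[of 0 "- z"] by simp
  moreover have "0 \<le> \<bar>z\<bar> ^ 3" by simp
  ultimately show ?thesis unfolding tanh_minus by linarith
qed

text \<open>In a field x the heat-bath probabilities of the two spins have ratio exp(2x), the Gibbs
  factor; this drives detailed balance.\<close>

lemma tanh_exp: "(1 - tanh x) * exp (2 * x) = 1 + tanh (x::real)"
proof -
  have "exp x + exp (- x) \<noteq> 0" by (metis add_pos_pos exp_gt_zero less_irrefl)
  moreover have "exp (2 * x) * exp (- x) = exp x" "exp (2 * x) = exp x * exp x"
    by (simp_all flip: exp_add)
  ultimately show ?thesis
    by (simp add: tanh_def sinh_field_def cosh_field_def field_simps)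
qed

section \<open>A gradient estimate for birth-death chains\<close>

text \<open>Jensen for a measure of mass w <= 1: w times the weighted sum of squares exceeds the
  square of the weighted sum by nonnegative pairwise terms.\<close>

lemma convex3_square:
  fixes a b c x y z :: real
  assumes "0 \<le> a" "0 \<le> b" "0 \<le> c" "a + b + c \<le> 1"
  shows "(a * x + b * y + c * z)\<^sup>2 \<le> a * x\<^sup>2 + b * y\<^sup>2 + c * z\<^sup>2"
proof -
  have "(a * x + b * y + c * z)\<^sup>2 + (a * b * (x - y)\<^sup>2 + a * c * (x - z)\<^sup>2 + b * c * (y - z)\<^sup>2)
     = (a + b + c) * (a * x\<^sup>2 + b * y\<^sup>2 + c * z\<^sup>2)"
    by (simp add: power2_eq_square algebra_simps)
  also have "\<dots> \<le> a * x\<^sup>2 + b * y\<^sup>2 + c * z\<^sup>2"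
    using assms by (intro mult_left_le_one_le) auto
  finally show ?thesis using assms by (rule_tac order_trans[rotated]) auto
qed

text \<open>The kernel acting on functions. Truncated subtraction at k = 0 and the outside value f
  (n + 1) at k = n carry the coefficients \<open>d 0\<close> and \<open>u n\<close>, which vanish
  for the chains below.\<close>

definition bd_step :: "(nat \<Rightarrow> real) \<Rightarrow> (nat \<Rightarrow> real) \<Rightarrow> (nat \<Rightarrow> real) \<Rightarrow> nat \<Rightarrow> real" where
  "bd_step u d f k = (1 - u k - d k) * f k + u k * f (k + 1) + d k * f (k - 1)"

text \<open>The kernel on edges (edge \<open>k\<close> joins \<open>k\<close> and \<open>k + 1\<close>) that intertwines with \<^const>\<open>bd_step\<close>
  through the discrete gradient.\<close>

definition grad_step :: "(nat \<Rightarrow> real) \<Rightarrow> (nat \<Rightarrow> real) \<Rightarrow> (nat \<Rightarrow> real) \<Rightarrow> nat \<Rightarrow> real" where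
  "grad_step u d g k = (1 - d (k + 1) - u k) * g k + u (k + 1) * g (k + 1) + d k * g (k - 1)"

definition grad :: "(nat \<Rightarrow> real) \<Rightarrow> nat \<Rightarrow> real" where
  "grad f k = f (k + 1) - f k"

text \<open>\<open>edge_le\<close> and \<open>contracting\<close> make \<open>grad_step\<close>
  sub-Markov; \<open>edge_ge\<close> makes every edge dissipate at rate \<alpha>;
  \<open>lazy\<close> keeps part of the squared increments in the one-step variance;
  \<open>u_lipschitz\<close> controls the energy error.\<close>

locale birth_death =
  fixes n :: nat and u d :: "nat \<Rightarrow> real" and \<alpha> b :: real
  assumes u_nonneg: "\<And>k. k \<le> n \<Longrightarrow> 0 \<le> u k" and d_nonneg: "\<And>k. k \<le> n \<Longrightarrow> 0 \<le> d k"
    and d_0: "d 0 = 0" and u_n: "u n = 0"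
    and lazy: "\<And>k. k \<le> n \<Longrightarrow> u k + d k \<le> 3 / 4"
    and edge_le: "\<And>k. k < n \<Longrightarrow> u k + d (k + 1) \<le> 1"
    and edge_ge: "\<And>k. k < n \<Longrightarrow> \<alpha> \<le> u k + d (k + 1)"
    and alpha_pos: "0 < \<alpha>"
    and u_lipschitz: "\<And>k. k < n \<Longrightarrow> \<bar>u (k + 1) - u k\<bar> \<le> b"
    and contracting: "\<And>k. k < n \<Longrightarrow> u (k + 1) + d k \<le> u k + d (k + 1)"
begin

lemma grad_bd_step:
  assumes "k < n" shows "grad (bd_step u d f) k = grad_step u d (grad f) k"
  using assms d_0 by (cases k) (auto simp: grad_def bd_step_def grad_step_def algebra_simps)

lemma grad_step_mono:
  assumes "\<And>k. k < n \<Longrightarrow> g k \<le> h k" "k < n" shows "grad_step u d g k \<le> grad_step u d h k"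
proof -
  have "u (k + 1) * g (k + 1) \<le> u (k + 1) * h (k + 1)"
    using assms u_nonneg[of "k + 1"] u_n
    by (cases "k + 1 = n") (auto intro!: mult_left_mono)
  moreover have "d k * g (k - 1) \<le> d k * h (k - 1)"
    using assms d_nonneg[of k] by (auto intro!: mult_left_mono)
  moreover have "(1 - d (k + 1) - u k) * g k \<le> (1 - d (k + 1) - u k) * h k"
    using assms edge_le[of k] by (auto intro!: mult_left_mono)
  ultimately show ?thesis by (simp add: grad_step_def)
qed

lemma grad_step_linear:
  "grad_step u d (\<lambda>k. g k + h k) k = grad_step u d g k + grad_step u d h k"
  "grad_step u d (\<lambda>k. c * g k) k = c * grad_step u d g k"
  by (auto simp: grad_step_def algebra_simps)

lemma bd_step_bounded:
  assumes "\<And>k. k \<le> n \<Longrightarrow> \<bar>f k\<bar> \<le> 1" "k \<le> n" shows "\<bar>bd_step u d f k\<bar> \<le> 1"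
proof -
  have "u k * \<bar>f (k + 1)\<bar> \<le> u k"
    using assms u_nonneg[of k] u_n by (cases "k = n") (auto intro!: mult_left_le)
  moreover have "d k * \<bar>f (k - 1)\<bar> \<le> d k"
    using assms d_nonneg[of k] by (auto intro!: mult_left_le)
  moreover have "(1 - u k - d k) * \<bar>f k\<bar> \<le> 1 - u k - d k"
    using assms lazy[of k] by (auto intro!: mult_left_le)
  moreover have "\<bar>bd_step u d f k\<bar> \<le> (1 - u k - d k) * \<bar>f k\<bar> + u k * \<bar>f (k + 1)\<bar> + d k * \<bar>f (k - 1)\<bar>"
    unfolding bd_step_def using assms u_nonneg[of k] d_nonneg[of k] lazy[of k]
    by (intro order_trans[OF abs_triangle_ineq] add_mono) (auto simp: abs_mult)
  ultimately show ?thesis by linarith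
qed

lemma bd_iter_bounded:
  assumes "\<And>k. k \<le> n \<Longrightarrow> \<bar>f k\<bar> \<le> 1" "k \<le> n" shows "\<bar>(bd_step u d ^^ m) f k\<bar> \<le> 1"
  using assms(2) by (induction m arbitrary: k) (auto simp: assms(1) intro!: bd_step_bounded)

lemma grad_step_square:
  assumes "k < n" shows "(grad_step u d g k)\<^sup>2 \<le> grad_step u d (\<lambda>k. (g k)\<^sup>2) k"
  unfolding grad_step_def
  using assms edge_le[of k] contracting[of k] u_nonneg[of "k + 1"] d_nonneg[of k]
  by (intro convex3_square) auto

text \<open>The one-step variance is v minus the squared mean increment. By Cauchy-Schwarz with mass
  \<open>u k + d k\<close>, at most 3/4, that square is at most 3v/4, so v/4 survives.\<close>

lemma bd_step_variance:
  assumes "k \<le> n"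
  shows "(bd_step u d f k)\<^sup>2 + u k * (f (k + 1) - f k)\<^sup>2 / 4 + d k * (f (k - 1) - f k)\<^sup>2 / 4
    \<le> bd_step u d (\<lambda>k. (f k)\<^sup>2) k"
proof -
  define x y where "x = f (k + 1) - f k" and "y = f (k - 1) - f k"
  define v where "v = u k * x\<^sup>2 + d k * y\<^sup>2"
  have ud: "0 \<le> u k" "0 \<le> d k" "u k + d k \<le> 3 / 4"
    using assms u_nonneg d_nonneg lazy by auto
  have f: "f (k + 1) = f k + x" "f (k - 1) = f k + y" by (auto simp: x_def y_def)
  have "bd_step u d (\<lambda>k. (f k)\<^sup>2) k - (bd_step u d f k)\<^sup>2 = v - (u k * x + d k * y)\<^sup>2"
    unfolding bd_step_def f v_def by (simp add: power2_eq_square algebra_simps)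
  moreover have "(u k + d k) * v - (u k * x + d k * y)\<^sup>2 = u k * d k * (x - y)\<^sup>2"
    by (simp add: v_def power2_eq_square algebra_simps)
  moreover have "0 \<le> u k * d k * (x - y)\<^sup>2" using ud by simp
  moreover have "(u k + d k) * v \<le> 3 / 4 * v"
    using ud by (intro mult_right_mono) (auto simp: v_def)
  ultimately have "(bd_step u d f k)\<^sup>2 + v / 4 \<le> bd_step u d (\<lambda>k. (f k)\<^sup>2) k" by linarith
  then show ?thesis by (simp add: v_def x_def y_def add_divide_distrib)
qed

text \<open>Comparing \<^const>\<open>grad_step\<close> with \<^const>\<open>bd_step\<close> at either endpoint of the edge gives the same
  error, whose linear part in the gradient is absorbed by the dissipation; the rest is the mass
  killed by \<^const>\<open>grad_step\<close>, which is summable along the edge chain.\<close>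

lemma energy_step:
  assumes f: "\<And>k. k \<le> n \<Longrightarrow> \<bar>f k\<bar> \<le> 1" and k: "k < n"
  shows "(bd_step u d f k)\<^sup>2 + (bd_step u d f (k + 1))\<^sup>2 + \<alpha> * (grad f k)\<^sup>2 / 8
    \<le> grad_step u d (\<lambda>k. (f k)\<^sup>2 + (f (k + 1))\<^sup>2) k + 32 * b\<^sup>2 / \<alpha> + 2 * (1 - grad_step u d (\<lambda>_. 1) k)"
proof -
  define D where "D = grad f k"
  define \<kappa> where "\<kappa> = 1 - grad_step u d (\<lambda>_. 1) k"
  have \<kappa>: "0 \<le> \<kappa>" "\<kappa> = d (k + 1) - d k - (u (k + 1) - u k)"
    using contracting[OF k] by (auto simp: \<kappa>_def grad_step_def)
  have pos: "0 \<le> u k" "0 \<le> d k" "0 \<le> u (k + 1)" "0 \<le> d (k + 1)"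
    using k u_nonneg d_nonneg by auto
  have v1: "(bd_step u d f k)\<^sup>2 + u k * D\<^sup>2 / 4 \<le> bd_step u d (\<lambda>k. (f k)\<^sup>2) k"
  proof -
    have "0 \<le> d k * (f (k - 1) - f k)\<^sup>2" using pos by simp
    then show ?thesis using bd_step_variance[OF less_imp_le[OF k], of f] unfolding D_def grad_def by linarith
  qed
  have v2: "(bd_step u d f (k + 1))\<^sup>2 + d (k + 1) * D\<^sup>2 / 4 \<le> bd_step u d (\<lambda>k. (f k)\<^sup>2) (k + 1)"
  proof -
    have "0 \<le> u (k + 1) * (f (k + 2) - f (k + 1))\<^sup>2" using pos by simp
    then show ?thesis using bd_step_variance[of "k + 1" f] k
      unfolding D_def grad_def by (simp add: power2_commute[of "f k"])
  qed
  \<comment> \<open>The increment of d is expressed through \<kappa> and the increment of u, so that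
    only a Lipschitz bound on u enters.\<close>
  have e1: "grad_step u d (\<lambda>k. (f k)\<^sup>2 + (f (k + 1))\<^sup>2) k
     = bd_step u d (\<lambda>k. (f k)\<^sup>2) k + bd_step u d (\<lambda>k. (f k)\<^sup>2) (k + 1)
       + 2 * ((u (k + 1) - u k) * ((f (k + 1))\<^sup>2 - (f k)\<^sup>2)) - 2 * (\<kappa> * (f k)\<^sup>2)"
    unfolding \<kappa>(2) using d_0 by (cases k) (auto simp: grad_step_def bd_step_def algebra_simps)
  have fk: "\<bar>f k\<bar> \<le> 1" "\<bar>f (k + 1)\<bar> \<le> 1" using f k by auto
  have "(f k)\<^sup>2 \<le> 1" using fk by (simp add: abs_square_le_1)
  then have e2: "\<kappa> * (f k)\<^sup>2 \<le> \<kappa>" using \<kappa> by (simp add: mult_left_le)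
  have b: "0 \<le> b" using u_lipschitz[OF k] by linarith
  have "\<bar>(u (k + 1) - u k) * ((f (k + 1))\<^sup>2 - (f k)\<^sup>2)\<bar> = \<bar>u (k + 1) - u k\<bar> * (\<bar>D\<bar> * \<bar>f (k + 1) + f k\<bar>)"
    by (simp add: abs_mult[symmetric] D_def grad_def power2_eq_square algebra_simps)
  also have "\<dots> \<le> b * (\<bar>D\<bar> * 2)"
    using u_lipschitz[OF k] fk b by (intro mult_mono) auto
  finally have e3: "\<bar>(u (k + 1) - u k) * ((f (k + 1))\<^sup>2 - (f k)\<^sup>2)\<bar> \<le> 2 * b * \<bar>D\<bar>" by simp
  \<comment> \<open>The square is scaled so that half of the dissipation \<alpha> D^2 / 4 pays for
    the linear error 4 b |D|.\<close>
  have "0 \<le> (\<alpha> * \<bar>D\<bar> - 16 * b)\<^sup>2 / (8 * \<alpha>)" using alpha_pos by simp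
  also have "\<dots> = \<alpha> * D\<^sup>2 / 8 - 4 * b * \<bar>D\<bar> + 32 * b\<^sup>2 / \<alpha>"
    using alpha_pos by (simp add: power2_diff power_mult_distrib field_simps power2_eq_square)
  finally have e4: "4 * b * \<bar>D\<bar> \<le> \<alpha> * D\<^sup>2 / 8 + 32 * b\<^sup>2 / \<alpha>" by simp
  have e5: "\<alpha> * D\<^sup>2 \<le> u k * D\<^sup>2 + d (k + 1) * D\<^sup>2"
    using edge_ge[OF k] by (simp add: mult_right_mono flip: distrib_right)
  show ?thesis
    unfolding D_def[symmetric] \<kappa>_def[symmetric] e1
    using v1 v2 e2 e3 e4 e5 by linarith
qed

text \<open>For fixed \<alpha> and b of order 1/n, the gradient is O(1/sqrt m) for all m up to order
  n^2.\<close>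

theorem gradient_bound:
  assumes f: "\<And>k. k \<le> n \<Longrightarrow> \<bar>f k\<bar> \<le> 1" and k: "k < n"
  shows "\<alpha> / 8 * (grad ((bd_step u d ^^ m) f) k)\<^sup>2 \<le> 2 / real (Suc m) + 32 * b\<^sup>2 / \<alpha>"
proof -
  define F where "F m = (bd_step u d ^^ m) f" for m
  define \<epsilon> where "\<epsilon> = 32 * b\<^sup>2 / \<alpha>"
  have \<epsilon>: "0 \<le> \<epsilon>" using alpha_pos by (simp add: \<epsilon>_def)
  txt \<open>\<open>W m\<close> is the squared gradient accumulated along the edge chain. Convexity makes each of its
    \<open>m\<close> summands at least the last squared gradient, and the energy bounds their total.\<close>
  define W where "W = rec_nat (\<lambda>_. 0) (\<lambda>m w k. grad_step u d w k + (grad (F m) k)\<^sup>2)"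
  have W: "W 0 k = 0" "W (Suc m) k = grad_step u d (W m) k + (grad (F m) k)\<^sup>2" for m k
    by (auto simp: W_def)
  have FS: "F (Suc m) = bd_step u d (F m)" for m by (simp add: F_def)
  have Fb: "\<bar>F m k\<bar> \<le> 1" if "k \<le> n" for m k
    unfolding F_def using f that by (rule bd_iter_bounded)
  have upper: "(F m k)\<^sup>2 + (F m (k + 1))\<^sup>2 + \<alpha> / 8 * W m k \<le> 2 + real m * \<epsilon>" if "k < n" for m k
    using that
  proof (induction m arbitrary: k)
    case 0
    then show ?case using Fb[of k 0] Fb[of "k + 1" 0] by (simp add: W flip: abs_square_le_1)
  next
    case (Suc m)
    have one: "grad_step u d (\<lambda>_. 1) k \<le> 1" using contracting[OF Suc.prems] by (simp add: grad_step_def)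
    have "(F (Suc m) k)\<^sup>2 + (F (Suc m) (k + 1))\<^sup>2 + \<alpha> / 8 * W (Suc m) k
      \<le> grad_step u d (\<lambda>k. (F m k)\<^sup>2 + (F m (k + 1))\<^sup>2) k + \<alpha> / 8 * grad_step u d (W m) k
        + \<epsilon> + 2 * (1 - grad_step u d (\<lambda>_. 1) k)"
      using energy_step[of "F m", OF Fb Suc.prems] by (simp add: FS W \<epsilon>_def algebra_simps)
    also have "grad_step u d (\<lambda>k. (F m k)\<^sup>2 + (F m (k + 1))\<^sup>2) k + \<alpha> / 8 * grad_step u d (W m) k
      = grad_step u d (\<lambda>k. (F m k)\<^sup>2 + (F m (k + 1))\<^sup>2 + \<alpha> / 8 * W m k) k"
      by (simp only: grad_step_linear)
    also have "\<dots> \<le> grad_step u d (\<lambda>_. 2 + real m * \<epsilon>) k"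
      using Suc by (intro grad_step_mono) auto
    also have "\<dots> = (2 + real m * \<epsilon>) * grad_step u d (\<lambda>_. 1) k"
      by (simp add: grad_step_def algebra_simps)
    \<comment> \<open>The constant 2 is preserved: the kernel removes 2 (1 - Q 1) from it, with Q
      the edge kernel, exactly the killed mass charged by the energy step.\<close>
    also have "\<dots> = 2 * grad_step u d (\<lambda>_. 1) k + real m * \<epsilon> * grad_step u d (\<lambda>_. 1) k"
      by (simp add: algebra_simps)
    also have "real m * \<epsilon> * grad_step u d (\<lambda>_. 1) k \<le> real m * \<epsilon>"
      using one \<epsilon> by (simp add: mult_left_le)
    finally show ?case by (simp add: algebra_simps)
  qed
  have lower: "real (Suc m) * (grad (F m) k)\<^sup>2 \<le> W (Suc m) k" if "k < n" for m k
    using that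
  proof (induction m arbitrary: k)
    case 0
    then show ?case by (auto simp: W(2)[of 0] grad_step_def W(1))
  next
    case (Suc m)
    have "(grad (F (Suc m)) k)\<^sup>2 \<le> grad_step u d (\<lambda>k. (grad (F m) k)\<^sup>2) k"
      unfolding FS grad_bd_step[OF Suc.prems] by (rule grad_step_square[OF Suc.prems])
    then have "real (Suc m) * (grad (F (Suc m)) k)\<^sup>2 \<le> grad_step u d (\<lambda>k. real (Suc m) * (grad (F m) k)\<^sup>2) k"
      unfolding grad_step_linear(2) by (intro mult_left_mono) auto
    also have "\<dots> \<le> grad_step u d (W (Suc m)) k" using Suc by (intro grad_step_mono) auto
    finally show ?case by (simp add: W(2)[of "Suc m"] algebra_simps)
  qed
  have "real (Suc m) * (\<alpha> / 8 * (grad (F m) k)\<^sup>2) \<le> \<alpha> / 8 * W (Suc m) k"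
    using lower[OF k, of m] alpha_pos by (simp add: mult_left_mono mult.left_commute)
  also have "\<dots> \<le> 2 + real (Suc m) * \<epsilon>"
    using upper[OF k, of "Suc m"] zero_le_power2[of "F (Suc m) k"] zero_le_power2[of "F (Suc m) (k+1)"]
    by linarith
  finally show ?thesis by (simp add: F_def \<epsilon>_def field_simps)
qed

end

section \<open>Expectations on a finite state space\<close>

definition mean :: "nat \<Rightarrow> (nat \<Rightarrow> real) \<Rightarrow> (nat \<Rightarrow> real) \<Rightarrow> real" where
  "mean n p f = (\<Sum>k=0..n. p k * f k)"

definition prob_vec :: "nat \<Rightarrow> (nat \<Rightarrow> real) \<Rightarrow> bool" where
  "prob_vec n p \<longleftrightarrow> (\<forall>k\<le>n. 0 \<le> p k) \<and> (\<Sum>k=0..n. p k) = 1"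

lemma mean_add: "mean n p (\<lambda>k. f k + g k) = mean n p f + mean n p g"
  by (simp add: mean_def sum.distrib distrib_left)

lemma mean_diff: "mean n p (\<lambda>k. f k - g k) = mean n p f - mean n p g"
  by (simp add: mean_def sum_subtractf right_diff_distrib)

lemma mean_cmult: "mean n p (\<lambda>k. c * f k) = c * mean n p f"
  by (simp add: mean_def sum_distrib_left mult.left_commute)

lemma mean_const: "prob_vec n p \<Longrightarrow> mean n p (\<lambda>_. c) = c"
  by (simp add: mean_def prob_vec_def flip: sum_distrib_right)

lemma mean_mono:
  "prob_vec n p \<Longrightarrow> (\<And>k. k \<le> n \<Longrightarrow> f k \<le> g k) \<Longrightarrow> mean n p f \<le> mean n p g"
  by (auto simp: mean_def prob_vec_def intro!: sum_mono mult_left_mono)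

lemma mean_cong: "(\<And>k. k \<le> n \<Longrightarrow> f k = g k) \<Longrightarrow> mean n p f = mean n p g"
  by (simp add: mean_def)

lemma mean_nonneg: "prob_vec n p \<Longrightarrow> (\<And>k. k \<le> n \<Longrightarrow> 0 \<le> f k) \<Longrightarrow> 0 \<le> mean n p f"
  by (auto simp: mean_def prob_vec_def intro!: sum_nonneg)

lemma mean_variance:
  assumes "prob_vec n p"
  shows "mean n p (\<lambda>k. (f k - c)\<^sup>2) = mean n p (\<lambda>k. (f k)\<^sup>2) - 2 * c * mean n p f + c\<^sup>2"
proof -
  have "mean n p (\<lambda>k. (f k - c)\<^sup>2) = mean n p (\<lambda>k. (f k)\<^sup>2 - 2 * c * f k + c\<^sup>2)"
    by (rule mean_cong) (simp add: power2_diff)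
  then show ?thesis by (simp add: mean_add mean_diff mean_cmult mean_const[OF assms])
qed

lemma mean_square_le:
  assumes "prob_vec n p" shows "(mean n p f)\<^sup>2 \<le> mean n p (\<lambda>k. (f k)\<^sup>2)"
  using mean_variance[OF assms, of f "mean n p f"] mean_nonneg[OF assms, of "\<lambda>k. (f k - mean n p f)\<^sup>2"]
  by (simp add: power2_eq_square)

lemma mean_pair_square:
  assumes "prob_vec n p" "prob_vec n q"
  shows "mean n p (\<lambda>k. mean n q (\<lambda>l. (f k - f l)\<^sup>2))
    = mean n p (\<lambda>k. (f k)\<^sup>2) - 2 * mean n p f * mean n q f + mean n q (\<lambda>k. (f k)\<^sup>2)"
proof -
  have "mean n q (\<lambda>l. (f k - f l)\<^sup>2) = mean n q (\<lambda>k. (f k)\<^sup>2) - 2 * mean n q f * f k + (f k)\<^sup>2" for k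
    using mean_variance[OF assms(2), of f "f k"] by (simp add: power2_commute mult.commute mult.left_commute)
  then show ?thesis by (simp add: mean_add mean_diff mean_cmult mean_const[OF assms(1)])
qed

text \<open>The variance is half the mean squared difference of two independent copies, and there
  the Lipschitz bound applies pointwise.\<close>

lemma variance_lipschitz:
  assumes p: "prob_vec n p"
    and lip: "\<And>k l. k \<le> n \<Longrightarrow> l \<le> n \<Longrightarrow> \<bar>g k - g l\<bar> \<le> r * \<bar>f k - f l\<bar>"
  shows "mean n p (\<lambda>k. (g k)\<^sup>2) - (mean n p g)\<^sup>2 \<le> r\<^sup>2 * (mean n p (\<lambda>k. (f k)\<^sup>2) - (mean n p f)\<^sup>2)"
proof -
  have "mean n p (\<lambda>k. mean n p (\<lambda>l. (g k - g l)\<^sup>2)) \<le> mean n p (\<lambda>k. mean n p (\<lambda>l. r\<^sup>2 * (f k - f l)\<^sup>2))"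
  proof (intro mean_mono p)
    fix k l assume "k \<le> n" "l \<le> n"
    then have "\<bar>g k - g l\<bar>\<^sup>2 \<le> (r * \<bar>f k - f l\<bar>)\<^sup>2" by (intro power_mono lip) auto
    then show "(g k - g l)\<^sup>2 \<le> r\<^sup>2 * (f k - f l)\<^sup>2" by (simp add: power_mult_distrib)
  qed
  then have "2 * (mean n p (\<lambda>k. (g k)\<^sup>2) - (mean n p g)\<^sup>2)
      \<le> 2 * (r\<^sup>2 * (mean n p (\<lambda>k. (f k)\<^sup>2) - (mean n p f)\<^sup>2))"
    unfolding mean_cmult mean_pair_square[OF p p] by (simp add: power2_eq_square algebra_simps)
  then show ?thesis by simp
qed

lemma chebyshev:
  assumes p: "prob_vec n p" and "0 < a"
  shows "mean n p (\<lambda>k. if a \<le> \<bar>f k - c\<bar> then 1 else 0) \<le> mean n p (\<lambda>k. (f k - c)\<^sup>2) / a\<^sup>2"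
proof -
  have "mean n p (\<lambda>k. if a \<le> \<bar>f k - c\<bar> then 1 else 0) \<le> mean n p (\<lambda>k. 1 / a\<^sup>2 * (f k - c)\<^sup>2)"
  proof (intro mean_mono p)
    fix k
    show "(if a \<le> \<bar>f k - c\<bar> then 1 else 0) \<le> 1 / a\<^sup>2 * (f k - c)\<^sup>2"
      using assms power_mono[of a "\<bar>f k - c\<bar>" 2] by (auto simp: field_simps)
  qed
  then show ?thesis by (simp only: mean_cmult) simp
qed

section \<open>The magnetization chain\<close>

lemma magn_Suc: "0 < n \<Longrightarrow> magn n (Suc k) = magn n k + 2 / real n"
  by (simp add: magn_def field_simps)

lemma magn_diff: "0 < n \<Longrightarrow> magn n k - magn n l = 2 / real n * (real k - real l)"
  by (simp add: magn_def field_simps)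

lemma magn_bounds: "k \<le> n \<Longrightarrow> - 1 \<le> magn n k \<and> magn n k \<le> 1"
  by (cases "n = 0") (auto simp: magn_def field_simps)

text \<open>Transitions leaving {0..n} contribute nothing: \<open>magn\<close> equals -1 at k = 0
  and 1 at k = n, which kills the corresponding rates.\<close>

lemma sum_trans:
  assumes "k \<le> n" "0 < n"
  shows "(\<Sum>j=0..n. trans n \<beta> k j * f j) = bd_step (p_up n \<beta>) (p_down n \<beta>) f k"
proof -
  have "(\<Sum>j=0..n. trans n \<beta> k j * f j)
     = (\<Sum>j=0..n. (if j = k then (1 - p_up n \<beta> k - p_down n \<beta> k) * f k else 0)
         + (if j = k + 1 then p_up n \<beta> k * f (k + 1) else 0)
         + (if k \<noteq> 0 then (if j = k - 1 then p_down n \<beta> k * f (k - 1) else 0) else 0))"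
    using assms by (intro sum.cong; cases k) (auto simp: trans_def)
  also have "\<dots> = bd_step (p_up n \<beta>) (p_down n \<beta>) f k"
    using assms
    by (cases "k = n"; cases "k = 0")
      (auto simp: sum.distrib bd_step_def p_up_def p_down_def magn_def)
  finally show ?thesis .
qed

lemma mean_dist_Suc:
  assumes "0 < n"
  shows "mean n (dist_t n \<beta> k0 (Suc t)) f = mean n (dist_t n \<beta> k0 t) (bd_step (p_up n \<beta>) (p_down n \<beta>) f)"
proof -
  have "mean n (dist_t n \<beta> k0 (Suc t)) f
     = (\<Sum>j=0..n. \<Sum>i=0..n. dist_t n \<beta> k0 t i * (trans n \<beta> i j * f j))"
    by (simp add: mean_def sum_distrib_right mult.assoc)
  also have "\<dots> = (\<Sum>i=0..n. dist_t n \<beta> k0 t i * (\<Sum>j=0..n. trans n \<beta> i j * f j))"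
    by (subst sum.swap) (simp add: sum_distrib_left)
  also have "\<dots> = mean n (dist_t n \<beta> k0 t) (bd_step (p_up n \<beta>) (p_down n \<beta>) f)"
    unfolding mean_def using assms by (intro sum.cong) (auto simp: sum_trans)
  finally show ?thesis .
qed

lemma mean_dist_0: "k0 \<le> n \<Longrightarrow> mean n (dist_t n \<beta> k0 0) f = f k0"
  by (simp add: mean_def if_distrib[of "\<lambda>x. x * _"] cong: if_cong)

text \<open>Markov property in dual form: the last m steps are moved from the law to the test
  function, where the gradient estimate applies.\<close>

lemma mean_dist_add:
  assumes "0 < n"
  shows "mean n (dist_t n \<beta> k0 (t + m)) f
    = mean n (dist_t n \<beta> k0 t) ((bd_step (p_up n \<beta>) (p_down n \<beta>) ^^ m) f)"
  by (induction m arbitrary: f)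
    (simp_all add: mean_dist_Suc[OF assms] funpow_swap1 del: dist_t.simps)

text \<open>\<delta> in (0,1] means 0 <= \<beta> < 1. The bound 2 <= n makes the lattice spacing 2/n
  at most 1 and the contraction factor 1 - \<delta>/n at least 1/2.\<close>

locale subcritical =
  fixes n :: nat and \<delta> :: real
  assumes n_ge_2: "2 \<le> n" and delta_pos: "0 < \<delta>" and delta_le_1: "\<delta> \<le> 1"
begin

abbreviation "\<beta> \<equiv> 1 - \<delta>"
abbreviation "S \<equiv> magn n"
abbreviation "u \<equiv> p_up n \<beta>"
abbreviation "d \<equiv> p_down n \<beta>"
abbreviation "P \<equiv> bd_step u d"

lemma n_pos: "0 < n" using n_ge_2 by simp

section \<open>Bounds on the transition rates of the magnetization\<close>

lemma rates:
  "u k = (1 - S k) * (1 + tanh (\<beta> * (S k + 1 / real n))) / 4"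
  "d k = (1 + S k) * (1 - tanh (\<beta> * (S k - 1 / real n))) / 4"
  by (simp_all add: p_up_def p_down_def Let_def)

lemma rates_nonneg: "k \<le> n \<Longrightarrow> 0 \<le> u k" "k \<le> n \<Longrightarrow> 0 \<le> d k"
  using magn_bounds[of k n] tanh_real_gt_neg1 tanh_real_lt_1
  unfolding rates by (auto intro!: mult_nonneg_nonneg simp: less_imp_le add_nonneg_nonneg intro: less_imp_le)
    (smt (verit))+

lemma two_sided_tanh_sign:
  assumes "0 \<le> h"
  shows "0 \<le> x * (tanh (\<beta> * (x + h)) + tanh (\<beta> * (x - h)))"
proof (cases "0 \<le> x")
  case True
  then have "- (\<beta> * (x - h)) \<le> \<beta> * (x + h)" using delta_le_1 by (simp add: mult_left_mono flip: mult_minus_right)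
  then have "tanh (- (\<beta> * (x - h))) \<le> tanh (\<beta> * (x + h))" by (simp only: tanh_real_le_iff)
  then show ?thesis using True by (intro mult_nonneg_nonneg) auto
next
  case False
  then have "\<beta> * (x + h) \<le> - (\<beta> * (x - h))" using delta_le_1 by (simp add: mult_left_mono flip: mult_minus_right)
  then have "tanh (\<beta> * (x + h)) \<le> tanh (- (\<beta> * (x - h)))" by (simp only: tanh_real_le_iff)
  then show ?thesis using False by (intro mult_nonpos_nonpos) auto
qed

text \<open>The rates sum to 1/2 + (a - b)/4 - S (a + b)/4. The last term only helps by the sign
  lemma, and a - b is at most the spacing 2/n <= 1.\<close>

lemma rates_lazy: "u k + d k \<le> 3 / 4"
proof -
  define a b where "a = tanh (\<beta> * (S k + 1 / real n))" and "b = tanh (\<beta> * (S k - 1 / real n))"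
  have "0 \<le> S k * (a + b)" unfolding a_def b_def by (rule two_sided_tanh_sign) simp
  moreover have "a - b \<le> 1"
  proof -
    have "\<beta> * (S k - 1 / real n) \<le> \<beta> * (S k + 1 / real n)"
      using delta_le_1 by (intro mult_left_mono) auto
    from tanh_diff_le[OF this] have "a - b \<le> \<beta> * (2 / real n)" by (simp add: a_def b_def algebra_simps)
    also have "\<dots> \<le> 1 * (2 / real n)" using delta_pos by (intro mult_right_mono) auto
    also have "\<dots> \<le> 1" using n_ge_2 by simp
    finally show ?thesis .
  qed
  moreover have "u k + d k = 1 / 2 + (a - b) / 4 - S k * (a + b) / 4"
    by (simp add: rates a_def b_def field_simps)
  ultimately show ?thesis by argo
qed

lemma S_edge: "k < n \<Longrightarrow> - 1 \<le> S k + 1 / real n \<and> S k + 1 / real n \<le> 1"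
  using n_pos by (auto simp: magn_def field_simps)

lemma abs_beta_mult_le: "\<bar>x\<bar> \<le> 1 \<Longrightarrow> \<bar>\<beta> * x\<bar> \<le> 1"
  using delta_pos delta_le_1 by (simp add: abs_mult mult_le_one)

lemma tanh_abs_le: assumes "\<bar>x\<bar> \<le> 1" shows "\<bar>tanh (\<beta> * x)\<bar> \<le> 11 / 12"
proof -
  have "tanh \<bar>\<beta> * x\<bar> \<le> tanh 1" using abs_beta_mult_le[OF assms] by (simp only: tanh_real_le_iff)
  also have "\<dots> \<le> 11 / 12" using tanh_upper_cubic[of 1] by simp
  finally show ?thesis by (simp add: tanh_real_abs)
qed

text \<open>Up from k and down from k + 1 see the same field, namely the magnetization at the
  midpoint of the edge, so a single tanh governs both.\<close>

lemma edge_rates: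
  "u k = (1 - S k) * (1 + tanh (\<beta> * (S k + 1 / real n))) / 4"
  "d (k + 1) = (1 + S k + 2 / real n) * (1 - tanh (\<beta> * (S k + 1 / real n))) / 4"
proof -
  have "S k + 2 / real n - 1 / real n = S k + 1 / real n" by (simp add: field_simps)
  then show "d (k + 1) = (1 + S k + 2 / real n) * (1 - tanh (\<beta> * (S k + 1 / real n))) / 4"
    by (simp add: rates(2) magn_Suc[OF n_pos] add.assoc)
qed (simp add: rates)

lemma edge_rates_le: "k < n \<Longrightarrow> u k + d (k + 1) \<le> 1"
proof -
  define h x T where "h = 1 / real n" and "x = S k + h" and "T = tanh (\<beta> * x)"
  have "d (k + 1) = (1 + S k + 2 * h) * (1 - T) / 4" "u k = (1 - S k) * (1 + T) / 4"
    unfolding edge_rates by (simp_all add: T_def x_def h_def)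
  then have "u k + d (k + 1) = 1 / 2 + h / 2 - x * T / 2"
    by (simp add: x_def field_simps)
  moreover have "0 \<le> x * T"
    using two_sided_tanh_sign[of 0 x] by (simp add: T_def)
  moreover have "h \<le> 1" using n_ge_2 by (simp add: h_def)
  ultimately show ?thesis by argo
qed

text \<open>Both factors 1 + T and 1 - T are at least 1/12, and their coefficients 1 - S and 1 + S +
  2/n add up to at least 2; division by 4 gives 1/24.\<close>

lemma edge_rates_ge: assumes "k < n" shows "1 / 24 \<le> u k + d (k + 1)"
proof -
  define T where "T = tanh (\<beta> * (S k + 1 / real n))"
  have T: "\<bar>T\<bar> \<le> 11 / 12" unfolding T_def using S_edge[OF assms] by (intro tanh_abs_le) auto
  have S: "-1 \<le> S k" "S k \<le> 1" using assms magn_bounds[of k n] by auto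
  have "(1 - S k) * (1 / 12) \<le> (1 - S k) * (1 + T)" using T S by (intro mult_left_mono) auto
  moreover have "(1 + S k + 2 / real n) * (1 / 12) \<le> (1 + S k + 2 / real n) * (1 - T)"
    using T S by (intro mult_left_mono) (auto intro!: add_nonneg_nonneg)
  moreover have "0 \<le> 2 / real n" by simp
  ultimately show ?thesis unfolding edge_rates T_def[symmetric] by argo
qed

lemma tanh_beta_diff:
  assumes "x \<le> y"
  shows "0 \<le> tanh (\<beta> * y) - tanh (\<beta> * x)" "tanh (\<beta> * y) - tanh (\<beta> * x) \<le> \<beta> * (y - x)"
proof -
  have *: "\<beta> * x \<le> \<beta> * y" using assms delta_le_1 by (intro mult_left_mono) auto
  show "0 \<le> tanh (\<beta> * y) - tanh (\<beta> * x)" using * by simp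
  show "tanh (\<beta> * y) - tanh (\<beta> * x) \<le> \<beta> * (y - x)"
    using tanh_diff_le[OF *] by (simp add: right_diff_distrib)
qed

lemma u_diff: assumes "k < n" shows "\<bar>u (k + 1) - u k\<bar> \<le> 2 / real n"
proof -
  define h T T1 where "h = 1 / real n" and "T = tanh (\<beta> * (S k + h))" and "T1 = tanh (\<beta> * (S k + 3 * h))"
  have h: "0 < h" using n_pos by (simp add: h_def)
  have u1: "u (k + 1) = (1 - S k - 2 * h) * (1 + T1) / 4"
    by (simp add: rates magn_Suc[OF n_pos] T1_def h_def add.assoc)
  have u0: "u k = (1 - S k) * (1 + T) / 4" by (simp add: rates T_def h_def)
  have "\<bar>T\<bar> \<le> 1" "\<bar>T1\<bar> \<le> 1"
    unfolding T_def T1_def by (simp_all add: abs_le_iff less_imp_le tanh_real_lt_1 tanh_real_gt_neg1 minus_le_iff)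
  have dT: "0 \<le> T1 - T" "T1 - T \<le> 2 * h"
  proof -
    show "0 \<le> T1 - T" unfolding T_def T1_def using h by (intro tanh_beta_diff) auto
    have "T1 - T \<le> \<beta> * (S k + 3 * h - (S k + h))"
      unfolding T_def T1_def using h by (intro tanh_beta_diff) auto
    also have "\<dots> \<le> 1 * (2 * h)" using h delta_pos by (simp add: mult_right_mono)
    finally show "T1 - T \<le> 2 * h" by simp
  qed
  have S: "-1 \<le> S k" "S k \<le> 1" using assms magn_bounds[of k n] by auto
  have eq: "u (k + 1) - u k = (1 - S k) * (T1 - T) / 4 - h * (1 + T1) / 2"
    unfolding u1 u0 by (simp add: field_simps)
  have "0 \<le> (1 - S k) * (T1 - T)" using S dT by simp
  moreover have "(1 - S k) * (T1 - T) \<le> 2 * (2 * h)" using S dT by (intro mult_mono) auto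
  moreover have "0 \<le> h * (1 + T1)" "h * (1 + T1) \<le> h * 2"
    using h \<open>\<bar>T1\<bar> \<le> 1\<close> by (auto intro!: mult_left_mono)
  ultimately have "\<bar>u (k + 1) - u k\<bar> \<le> 2 * h" unfolding eq by linarith
  then show ?thesis by (simp add: h_def)
qed

text \<open>The linear part of the rates contributes -1/n, while the 1-Lipschitz tanh gives back at
  most \<beta>/n. This makes the edge kernel sub-Markov and also contracts the mean
  magnetization.\<close>

lemma rates_contract:
  assumes "k < n" shows "u (k + 1) + d k - u k - d (k + 1) \<le> - (\<delta> / real n)"
proof -
  define h T T1 Tm where "h = 1 / real n" and "T = tanh (\<beta> * (S k + h))"
    and "T1 = tanh (\<beta> * (S k + 3 * h))" and "Tm = tanh (\<beta> * (S k - h))"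
  have h: "0 < h" using n_pos by (simp add: h_def)
  have u1: "u (k + 1) = (1 - S k - 2 * h) * (1 + T1) / 4"
    by (simp add: rates magn_Suc[OF n_pos] T1_def h_def add.assoc)
  have d1: "d (k + 1) = (1 + S k + 2 * h) * (1 - T) / 4"
    unfolding edge_rates by (simp add: T_def h_def)
  have r: "u k = (1 - S k) * (1 + T) / 4" "d k = (1 + S k) * (1 - Tm) / 4"
    by (simp_all add: rates T_def Tm_def h_def)
  have S: "-1 \<le> S k" "0 \<le> 1 - S k - 2 * h"
    using assms magn_bounds[of k n] magn_bounds[of "Suc k" n] magn_Suc[OF n_pos, of k]
    by (auto simp: h_def)
  have dT: "T1 - T \<le> \<beta> * (2 * h)" "T - Tm \<le> \<beta> * (2 * h)"
    using tanh_beta_diff(2)[of "S k + h" "S k + 3 * h"] tanh_beta_diff(2)[of "S k - h" "S k + h"] h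
    by (auto simp: T_def T1_def Tm_def)
  have "(1 - S k - 2 * h) * (T1 - T) \<le> (1 - S k - 2 * h) * (\<beta> * (2 * h))"
    using S dT by (intro mult_left_mono) auto
  moreover have "(1 + S k) * (T - Tm) \<le> (1 + S k) * (\<beta> * (2 * h))"
    using S dT by (intro mult_left_mono) auto
  moreover have "0 \<le> \<beta> * (h * h)" using delta_le_1 by simp
  moreover have "u (k + 1) + d k - u k - d (k + 1) =
      ((1 - S k - 2 * h) * (T1 - T) + (1 + S k) * (T - Tm)) / 4 - h"
    unfolding u1 d1 r by (simp add: field_simps)
  ultimately have "u (k + 1) + d k - u k - d (k + 1) \<le> \<beta> * h - h"
    by (simp add: algebra_simps)
  also have "\<dots> = - (\<delta> / real n)" by (simp add: h_def diff_divide_distrib)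
  finally show ?thesis .
qed

lemma rates_0: "d 0 = 0" and rates_n: "u n = 0"
  using n_pos by (auto simp: rates magn_def)

sublocale birth_death n u d "1 / 24" "2 / real n"
proof
  fix k assume "k < n"
  then show "u (k + 1) + d k \<le> u k + d (k + 1)"
    using rates_contract[of k] delta_pos n_pos by (smt (verit) divide_pos_pos of_nat_0_less_iff)
qed (use rates_nonneg rates_lazy edge_rates_le edge_rates_ge u_diff rates_0 rates_n in auto)

end

lemma lipschitz_of_adjacent:
  fixes F :: "nat \<Rightarrow> real"
  assumes adj: "\<And>k. k < n \<Longrightarrow> \<bar>F (k + 1) - F k\<bar> \<le> L" and "k \<le> n" "l \<le> n"
  shows "\<bar>F k - F l\<bar> \<le> L * \<bar>real k - real l\<bar>"
proof -
  have up: "\<bar>F (k + m) - F k\<bar> \<le> L * real m" if "k + m \<le> n" for k m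
    using that
  proof (induction m)
    case (Suc m)
    then show ?case using adj[of "k + m"] by (simp add: algebra_simps)
  qed simp
  show ?thesis
  proof (cases "k \<le> l")
    case True
    then show ?thesis using up[of k "l - k"] assms by (simp add: abs_minus_commute of_nat_diff)
  next
    case False
    then show ?thesis using up[of l "k - l"] assms by (simp add: of_nat_diff)
  qed
qed

section \<open>Stationarity\<close>

text \<open>Expanding the square of the total spin, with diagonal terms 1. Hence the Gibbs weight
  depends on the configuration only through its number of plus spins.\<close>

lemma sum_pairs_eq:
  fixes \<sigma> :: "nat \<Rightarrow> real"
  assumes "\<And>x. (\<sigma> x)\<^sup>2 = 1"
  shows "2 * (\<Sum>(x,y)\<in>{(x,y). x < y \<and> y < n}. \<sigma> x * \<sigma> y) = (\<Sum>x<n. \<sigma> x)\<^sup>2 - real n"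
proof (induction n)
  case (Suc n)
  have split: "{(x,y). x < y \<and> y < Suc n} = {(x,y). x < y \<and> y < n} \<union> (\<lambda>x. (x, n)) ` {..<n}"
    by (auto simp: less_Suc_eq)
  have fin: "finite {(x,y). x < y \<and> y < n}"
    by (rule finite_subset[of _ "{..<n} \<times> {..<n}"]) auto
  have "(\<Sum>(x,y)\<in>{(x,y). x < y \<and> y < Suc n}. \<sigma> x * \<sigma> y)
     = (\<Sum>(x,y)\<in>{(x,y). x < y \<and> y < n}. \<sigma> x * \<sigma> y) + (\<Sum>x<n. \<sigma> x * \<sigma> n)"
    unfolding split by (subst sum.union_disjoint) (auto simp: fin sum.reindex inj_on_def)
  then show ?case using Suc assms[of n]
    by (simp add: power2_sum algebra_simps sum_distrib_left)
qed simp

lemma ising_weight_eq: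
  assumes "A \<subseteq> {0..<n}"
  shows "ising_weight n \<beta> A = exp (\<beta> / real n * (((2 * real (card A) - real n)\<^sup>2 - real n) / 2))"
proof -
  have "(\<Sum>x<n. spin A x) = (\<Sum>x<n. 2 * (if x \<in> A then 1 else 0) - 1)"
    by (intro sum.cong) (auto simp: spin_def)
  also have "\<dots> = 2 * real (card ({..<n} \<inter> A)) - real n"
    by (simp add: sum_subtractf sum.If_cases flip: sum_distrib_left)
  also have "{..<n} \<inter> A = A" using assms by auto
  finally have "(\<Sum>x<n. spin A x) = 2 * real (card A) - real n" .
  moreover have "(spin A x)\<^sup>2 = 1" for x by (simp add: spin_def)
  ultimately have "2 * (\<Sum>(x,y)\<in>{(x,y). x < y \<and> y < n}. spin A x * spin A y) = (2 * real (card A) - real n)\<^sup>2 - real n"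
    using sum_pairs_eq[of "spin A" n] by simp
  then have "(\<Sum>(x,y)\<in>{(x,y). x < y \<and> y < n}. spin A x * spin A y) = ((2 * real (card A) - real n)\<^sup>2 - real n) / 2"
    by simp
  then show ?thesis by (simp only: ising_weight_def)
qed

lemma ising_Z_pos: "0 < ising_Z n \<beta>"
  unfolding ising_Z_def ising_weight_def by (intro sum_pos) auto

lemma pi_n_eq:
  "pi_n n \<beta> k = real (n choose k) * exp (\<beta> / real n * (((2 * real k - real n)\<^sup>2 - real n) / 2)) / ising_Z n \<beta>"
proof -
  have "pi_n n \<beta> k = (\<Sum>A\<in>{A. A \<subseteq> {0..<n} \<and> card A = k}.
      exp (\<beta> / real n * (((2 * real k - real n)\<^sup>2 - real n) / 2)) / ising_Z n \<beta>)"
    unfolding pi_n_def ising_mu_def by (intro sum.cong) (auto simp: ising_weight_eq)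
  then show ?thesis by (simp add: n_subsets)
qed

lemma prob_vec_pi: "prob_vec n (pi_n n \<beta>)"
proof -
  have "(\<Sum>k=0..n. pi_n n \<beta> k) = (\<Sum>k=0..n. \<Sum>A\<in>{A\<in>Pow {0..<n}. card A = k}. ising_mu n \<beta> A)"
    by (simp add: pi_n_def)
  also have "\<dots> = (\<Sum>A\<in>Pow {0..<n}. ising_mu n \<beta> A)"
    by (rule sum.group) (auto dest: card_mono[rotated])
  also have "\<dots> = 1"
    using ising_Z_pos[of n \<beta>] by (simp add: ising_mu_def flip: sum_divide_distrib ising_Z_def)
  finally have "(\<Sum>k=0..n. pi_n n \<beta> k) = 1" .
  moreover have "0 \<le> pi_n n \<beta> k" for k
    using ising_Z_pos[of n \<beta>] by (simp add: pi_n_eq)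
  ultimately show ?thesis by (simp add: prob_vec_def)
qed

text \<open>Crossing the edge multiplies the Gibbs weight by exp(2x), with x the midpoint field
  times \<beta>. \<open>tanh_exp\<close> matches this with the spin probabilities, and binomial
  absorption matches the numbers of available vertices.\<close>

lemma detailed_balance:
  assumes "k < n"
  shows "pi_n n \<beta> k * p_up n \<beta> k = pi_n n \<beta> (k + 1) * p_down n \<beta> (k + 1)"
proof -
  define x where "x = \<beta> * (magn n k + 1 / real n)"
  define w where "w k = exp (\<beta> / real n * (((2 * real k - real n)\<^sup>2 - real n) / 2))" for k
  have n: "real n \<noteq> 0" using assms by simp
  have "\<beta> / real n * (((2 * real (k + 1) - real n)\<^sup>2 - real n) / 2)
      = \<beta> / real n * (((2 * real k - real n)\<^sup>2 - real n) / 2) + 2 * x"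
    using n by (simp add: x_def magn_def power2_eq_square field_simps)
  then have w: "w (k + 1) = w k * exp (2 * x)" by (simp only: w_def exp_add)
  have b: "real (n choose k) * (real n - real k) = real (n choose (k + 1)) * real (k + 1)"
  proof -
    have "Suc k * (n choose Suc k) = (n - k) * (n choose k)"
      using binomial_absorb_comp[of n k] binomial_absorption[of k n] assms by (simp add: mult.commute)
    then have "real (Suc k * (n choose Suc k)) = real ((n - k) * (n choose k))" by simp
    then show ?thesis using assms by (simp add: of_nat_diff algebra_simps)
  qed
  have up: "p_up n \<beta> k = (real n - real k) * (1 + tanh x) / (2 * real n)"
    unfolding p_up_def Let_def x_def[symmetric] using n by (simp add: magn_def field_simps)
  have m: "magn n (k + 1) - 1 / real n = magn n k + 1 / real n"
    using n by (simp add: magn_def field_simps)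
  have down: "p_down n \<beta> (k + 1) = real (k + 1) * (1 - tanh x) / (2 * real n)"
    unfolding p_down_def Let_def m x_def[symmetric] using n by (simp add: magn_def field_simps)
  have "pi_n n \<beta> (k + 1) * p_down n \<beta> (k + 1)
      = real (n choose (k + 1)) * real (k + 1) * (w k * ((1 - tanh x) * exp (2 * x))) / (ising_Z n \<beta> * (2 * real n))"
    unfolding pi_n_eq w_def[symmetric] w down by simp
  also have "\<dots> = pi_n n \<beta> k * p_up n \<beta> k"
    unfolding tanh_exp b[symmetric] pi_n_eq w_def[symmetric] up by simp
  finally show ?thesis ..
qed

lemma mean_pi_step:
  assumes "0 < n"
  shows "mean n (pi_n n \<beta>) (bd_step (p_up n \<beta>) (p_down n \<beta>) f) = mean n (pi_n n \<beta>) f"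
proof -
  let ?\<pi> = "pi_n n \<beta>" and ?u = "p_up n \<beta>" and ?d = "p_down n \<beta>"
  have "mean n ?\<pi> (bd_step ?u ?d f) - mean n ?\<pi> f
     = (\<Sum>k=0..n. ?\<pi> k * ?u k * (f (k + 1) - f k)) - (\<Sum>k=0..n. ?\<pi> k * ?d k * (f k - f (k - 1)))"
    by (simp add: mean_def bd_step_def algebra_simps flip: sum_subtractf sum.distrib)
  \<comment> \<open>Since the up rate vanishes at n and the down rate at 0, both sums become sums
    over edges, which cancel term by term.\<close>
  also have "(\<Sum>k=0..n. ?\<pi> k * ?u k * (f (k + 1) - f k)) = (\<Sum>k<n. ?\<pi> k * ?u k * (f (k + 1) - f k))"
    using assms by (simp add: atLeast0AtMost lessThan_Suc_atMost[symmetric] p_up_def magn_def)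
  also have "(\<Sum>k=0..n. ?\<pi> k * ?d k * (f k - f (k - 1))) = (\<Sum>k<n. ?\<pi> (k + 1) * ?d (k + 1) * (f (k + 1) - f k))"
    by (simp add: atLeast0AtMost sum.atMost_shift p_down_def magn_def)
  also have "(\<Sum>k<n. ?\<pi> k * ?u k * (f (k + 1) - f k)) - \<dots> = 0"
    using detailed_balance[of _ n \<beta>] by (simp flip: sum_subtractf)
  finally show ?thesis by simp
qed

lemma mean_pi_iter:
  assumes "0 < n"
  shows "mean n (pi_n n \<beta>) ((bd_step (p_up n \<beta>) (p_down n \<beta>) ^^ m) f) = mean n (pi_n n \<beta>) f"
  by (induction m) (simp_all add: mean_pi_step[OF assms])

section \<open>One-step drift and moments of the magnetization\<close>

context subcritical
begin

abbreviation "\<rho> \<equiv> 1 - \<delta> / real n"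

lemma rho_bounds: "1 / 2 \<le> \<rho>" "\<rho> < 1"
proof -
  have "\<delta> / real n \<le> 1 / 2" using delta_le_1 n_ge_2 by (intro frac_le) auto
  then show "1 / 2 \<le> \<rho>" by simp
qed (use delta_pos n_pos in auto)

lemma one_minus_rho_square: "\<delta> / real n \<le> 1 - \<rho>\<^sup>2"
proof -
  have "\<rho>\<^sup>2 \<le> \<rho>" unfolding power2_eq_square by (intro mult_left_le) (use rho_bounds in linarith)+
  then show ?thesis by linarith
qed

lemma prob_vec_dist: "k0 \<le> n \<Longrightarrow> prob_vec n (dist_t n \<beta> k0 t)"
proof (induction t)
  case 0
  then show ?case by (auto simp: prob_vec_def)
next
  case (Suc t)
  have "0 \<le> dist_t n \<beta> k0 (Suc t) j" if "j \<le> n" for j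
  proof -
    have "0 \<le> trans n \<beta> i j" for i
      using rates_nonneg[of i] rates_lazy[of i] by (auto simp: trans_def)
    then show ?thesis using Suc by (auto simp: prob_vec_def intro!: sum_nonneg)
  qed
  moreover have "(\<Sum>k=0..n. dist_t n \<beta> k0 (Suc t) k) = 1"
  proof -
    have "mean n (dist_t n \<beta> k0 (Suc t)) (\<lambda>_. 1) = mean n (dist_t n \<beta> k0 t) (\<lambda>_. 1)"
      unfolding mean_dist_Suc[OF n_pos] by (intro mean_cong) (simp add: bd_step_def)
    then show ?thesis using Suc mean_const[of n "dist_t n \<beta> k0 t" 1] by (simp add: mean_def)
  qed
  ultimately show ?case by (simp add: prob_vec_def)
qed

declare dist_t.simps [simp del]

text \<open>At k = 0 the truncated predecessor does not have magnetization
  \<open>S k - 2 / real n\<close>, but \<open>d 0 = 0\<close> hides this.\<close>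

lemma step_magn:
  assumes "k \<le> n"
  shows "P (\<lambda>k. \<phi> (S k)) k = (1 - u k - d k) * \<phi> (S k) + u k * \<phi> (S k + 2 / real n) + d k * \<phi> (S k - 2 / real n)"
proof (cases k)
  case 0
  then show ?thesis by (simp add: bd_step_def rates_0 magn_Suc[OF n_pos])
next
  case (Suc m)
  then have "S (k - 1) = S k - 2 / real n" using magn_Suc[OF n_pos, of m] by simp
  then show ?thesis by (simp add: bd_step_def magn_Suc[OF n_pos])
qed

text \<open>\<open>2 * (u k - d k)\<close> is n times the expected increment of the magnetization in
  one step.\<close>

lemma drift_eq:
  "2 * (u k - d k) = ((1 - S k) * tanh (\<beta> * (S k + 1 / real n)) + (1 + S k) * tanh (\<beta> * (S k - 1 / real n))) / 2 - S k"
  by (simp add: rates field_simps)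

text \<open>The average of the shifted tanh values is handled by the midpoint inequality, and their
  difference enters with a favourable sign by monotonicity. The cubic gap of tanh at \<beta> s then
  gives the quartic term.\<close>

lemma drift_upper:
  assumes "k \<le> n"
  shows "S k * (2 * (u k - d k)) \<le> - \<delta> * (S k)\<^sup>2 - \<beta> ^ 3 * (S k) ^ 4 / 12"
proof -
  define s h where "s = S k" and "h = 1 / real n"
  define a b where "a = tanh (\<beta> * (s + h))" and "b = tanh (\<beta> * (s - h))"
  have s: "\<bar>s\<bar> \<le> 1" using magn_bounds[OF assms] by (auto simp: s_def)
  have ba: "b \<le> a" using tanh_beta_diff(1)[of "s - h" "s + h"] by (simp add: a_def b_def h_def)
  define p q where "p = s * ((a + b) / 2)" and "q = s\<^sup>2 * (a - b)"
  have "s * (2 * (u k - d k)) = p - q / 2 - s\<^sup>2"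
    unfolding p_def q_def drift_eq s_def[symmetric] h_def[symmetric] a_def[symmetric] b_def[symmetric]
    by (simp add: field_simps power2_eq_square)
  moreover have "0 \<le> q" using ba by (simp add: q_def)
  moreover have "p \<le> s * tanh (\<beta> * s)"
    using tanh_midpoint_mult_le[of \<beta> s "\<beta> * h"] delta_le_1 by (simp add: p_def a_def b_def algebra_simps)
  \<comment> \<open>The bound for z tanh z at z = \<beta> s carries an extra factor \<beta>, which
    may be cancelled only for \<beta> > 0; at \<beta> = 0 both sides vanish.\<close>
  moreover have "s * tanh (\<beta> * s) \<le> \<beta> * s\<^sup>2 - \<beta> ^ 3 * s ^ 4 / 12"
  proof (cases "\<beta> = 0")
    case False
    then have \<beta>: "0 < \<beta>" using delta_le_1 by simp
    have "\<beta> * (s * tanh (\<beta> * s)) \<le> (\<beta> * s)\<^sup>2 - (\<beta> * s) ^ 4 / 12"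
      using mult_tanh_le[OF abs_beta_mult_le[OF s]] by (simp add: mult.assoc)
    also have "\<dots> = \<beta> * (\<beta> * s\<^sup>2 - \<beta> ^ 3 * s ^ 4 / 12)"
      by (simp only: power_mult_distrib right_diff_distrib power2_eq_square power4_eq_xxxx power3_eq_cube
          times_divide_eq_right mult_ac)
    finally show ?thesis using \<beta> by simp
  qed simp
  moreover have "\<beta> * s\<^sup>2 = s\<^sup>2 - \<delta> * s\<^sup>2" by (simp add: left_diff_distrib)
  ultimately show ?thesis unfolding s_def[symmetric] by linarith
qed

lemma drift_upper_linear:
  assumes "k \<le> n" shows "S k * (2 * (u k - d k)) \<le> - \<delta> * (S k)\<^sup>2"
proof -
  have "0 \<le> \<beta> ^ 3 * (S k) ^ 4" using delta_le_1 by simp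
  then show ?thesis using drift_upper[OF assms] by linarith
qed

text \<open>Replacing tanh by its argument costs a cubic remainder; the shifts by 1/n then leave
  only \<beta> s / n beyond the linear drift.\<close>

lemma drift_lower:
  assumes "k \<le> n"
  shows "- \<delta> * S k - \<bar>S k\<bar> / real n - (\<bar>S k\<bar> + 1 / real n) ^ 3 / 3 \<le> 2 * (u k - d k)"
proof -
  define s h where "s = S k" and "h = 1 / real n"
  have s: "\<bar>s\<bar> \<le> 1" using magn_bounds[OF assms] by (auto simp: s_def)
  have h: "0 \<le> h" by (simp add: h_def)
  have tl: "\<beta> * x - (\<bar>s\<bar> + h) ^ 3 / 3 \<le> tanh (\<beta> * x)" if "\<bar>x\<bar> \<le> \<bar>s\<bar> + h" for x
  proof -
    have "\<bar>\<beta> * x\<bar> \<le> 1 * (\<bar>s\<bar> + h)"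
      unfolding abs_mult using that delta_pos delta_le_1 by (intro mult_mono) auto
    then have "\<bar>\<beta> * x\<bar> ^ 3 \<le> (\<bar>s\<bar> + h) ^ 3" by (intro power_mono) auto
    then show ?thesis using tanh_ge_cubic[of "\<beta> * x"] by linarith
  qed
  define g e c X Y X' Y' where "g = \<bar>s\<bar> / real n" and "e = \<beta> * s * h" and "c = (\<bar>s\<bar> + h) ^ 3 / 3"
    and "X = (1 - s) * tanh (\<beta> * (s + h))" and "Y = (1 + s) * tanh (\<beta> * (s - h))"
    and "X' = (1 - s) * (\<beta> * (s + h) - c)" and "Y' = (1 + s) * (\<beta> * (s - h) - c)"
  have "X' \<le> X"
    unfolding X_def X'_def c_def using s h by (intro mult_left_mono tl) auto
  moreover have "Y' \<le> Y"
    unfolding Y_def Y'_def c_def using s h by (intro mult_left_mono tl) auto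
  moreover have "(X' + Y') / 2 - s = - \<delta> * s - e - c"
    by (simp add: e_def X'_def Y'_def field_simps)
  moreover have "e \<le> g"
  proof -
    have "\<bar>\<beta> * s\<bar> \<le> 1 * \<bar>s\<bar>" unfolding abs_mult using delta_pos delta_le_1 by (intro mult_right_mono) auto
    then have "\<beta> * s * h \<le> \<bar>s\<bar> * h" using h by (intro mult_right_mono) auto
    then show ?thesis by (simp add: e_def g_def h_def)
  qed
  moreover have "2 * (u k - d k) = (X + Y) / 2 - s"
    unfolding drift_eq X_def Y_def s_def h_def ..
  ultimately have "- \<delta> * s - g - c \<le> 2 * (u k - d k)" by argo
  then show ?thesis by (simp add: g_def c_def s_def h_def)
qed

lemma step_magn_mean: "k \<le> n \<Longrightarrow> P S k = S k + 2 / real n * (u k - d k)"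
  using step_magn[of k "\<lambda>x. x"] by (simp add: algebra_simps)

lemma step_magn_square_eq:
  assumes "k \<le> n"
  shows "P (\<lambda>k. (S k)\<^sup>2) k = (S k)\<^sup>2 + 2 / real n * (S k * (2 * (u k - d k))) + (2 / real n)\<^sup>2 * (u k + d k)"
proof -
  define h where "h = 2 / real n"
  show ?thesis
    unfolding step_magn[of k "\<lambda>x. x\<^sup>2", OF assms] h_def[symmetric]
    by (simp add: power2_eq_square algebra_simps)
qed

lemma rate_sum_le_1: "k \<le> n \<Longrightarrow> u k + d k \<le> 1"
  using rates_lazy[of k] by linarith

lemma step_magn_square:
  assumes "k \<le> n"
  shows "P (\<lambda>k. (S k)\<^sup>2) k \<le> (S k)\<^sup>2 - 2 / real n * (\<delta> * (S k)\<^sup>2 + \<beta> ^ 3 * (S k) ^ 4 / 12) + 4 / (real n)\<^sup>2"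
proof -
  have "2 / real n * (S k * (2 * (u k - d k))) \<le> 2 / real n * (- \<delta> * (S k)\<^sup>2 - \<beta> ^ 3 * (S k) ^ 4 / 12)"
    by (intro mult_left_mono drift_upper assms) auto
  moreover have "(2 / real n)\<^sup>2 * (u k + d k) \<le> (2 / real n)\<^sup>2"
    using rate_sum_le_1[OF assms] by (intro mult_left_le) auto
  moreover have "(2 / real n)\<^sup>2 = 4 / (real n)\<^sup>2" by (simp add: power_divide)
  ultimately show ?thesis unfolding step_magn_square_eq[OF assms] by (simp add: algebra_simps)
qed

lemma step_magn_variance:
  assumes "k \<le> n" shows "P (\<lambda>k. (S k)\<^sup>2) k \<le> (P S k)\<^sup>2 + 4 / (real n)\<^sup>2"
proof -
  have "P (\<lambda>k. (S k)\<^sup>2) k = (P S k)\<^sup>2 + (2 / real n)\<^sup>2 * (u k + d k) - (2 / real n)\<^sup>2 * (u k - d k)\<^sup>2"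
  proof -
    define h where "h = 2 / real n"
    show ?thesis
      unfolding step_magn_square_eq[OF assms] step_magn_mean[OF assms] h_def[symmetric]
      by (simp add: power2_eq_square algebra_simps)
  qed
  moreover have "(2 / real n)\<^sup>2 * (u k + d k) \<le> (2 / real n)\<^sup>2"
    using rate_sum_le_1[OF assms] by (intro mult_left_le) auto
  moreover have "(2 / real n)\<^sup>2 = 4 / (real n)\<^sup>2" by (simp add: power_divide)
  moreover have "0 \<le> (2 / real n)\<^sup>2 * (u k - d k)\<^sup>2" by simp
  ultimately show ?thesis by linarith
qed

text \<open>With spacing h, the odd terms 4 s^3 h and 4 s h^3 combine into a multiple of s times the
  drift, hence contract; the even terms 6 s^2 h^2 + h^4 are the noise.\<close>

lemma step_magn_fourth:
  assumes "k \<le> n"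
  shows "P (\<lambda>k. (S k) ^ 4) k \<le> (1 - 4 * (\<delta> / real n)) * (S k) ^ 4 + 24 / (real n)\<^sup>2 * (S k)\<^sup>2 + 16 / (real n) ^ 4"
proof -
  define s h where "s = S k" and "h = 2 / real n"
  have h: "0 \<le> h" by (simp add: h_def)
  have "P (\<lambda>k. (S k) ^ 4) k
     = s ^ 4 + 2 * h * (s\<^sup>2 + h\<^sup>2) * (s * (2 * (u k - d k))) + (u k + d k) * (6 * h\<^sup>2 * s\<^sup>2 + h ^ 4)"
    unfolding step_magn[of k "\<lambda>x. x ^ 4", OF assms] s_def[symmetric] h_def[symmetric]
    by (simp add: power2_eq_square power4_eq_xxxx algebra_simps)
  moreover have "2 * h * (s\<^sup>2 + h\<^sup>2) * (s * (2 * (u k - d k))) \<le> 2 * h * (s\<^sup>2 + h\<^sup>2) * (- \<delta> * s\<^sup>2)"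
    unfolding s_def using h by (intro mult_left_mono drift_upper_linear assms) auto
  moreover have "0 \<le> 2 * h * h\<^sup>2 * \<delta> * s\<^sup>2" using h delta_pos by simp
  moreover have "(u k + d k) * (6 * h\<^sup>2 * s\<^sup>2 + h ^ 4) \<le> 6 * h\<^sup>2 * s\<^sup>2 + h ^ 4"
    using rate_sum_le_1[OF assms] rates_nonneg[OF assms] h by (intro mult_left_le_one_le) auto
  ultimately have "P (\<lambda>k. (S k) ^ 4) k \<le> s ^ 4 - 2 * h * \<delta> * s ^ 4 + 6 * h\<^sup>2 * s\<^sup>2 + h ^ 4"
    by (simp add: algebra_simps power2_eq_square power4_eq_xxxx)
  then show ?thesis by (simp add: s_def h_def power_divide algebra_simps)
qed

text \<open>Adjacent states keep their order in mean (\<open>edge_rates_le\<close>) and approach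
  each other by the factor \<rho> (\<open>rates_contract\<close>); summing along the path between
  the states gives the claim.\<close>

lemma step_magn_lipschitz:
  assumes "k \<le> n" "l \<le> n"
  shows "\<bar>P S k - P S l\<bar> \<le> \<rho> * \<bar>S k - S l\<bar>"
proof -
  have "\<bar>P S (k + 1) - P S k\<bar> \<le> \<rho> * (2 / real n)" if "k < n" for k
  proof -
    define q where "q = 1 + (u (k + 1) + d k - u k - d (k + 1))"
    have q: "0 \<le> q" "q \<le> \<rho>"
      using rates_contract[OF that] edge_rates_le[OF that] rates_nonneg[of "k + 1"] rates_nonneg[of k] that
      by (auto simp: q_def)
    have "P S (k + 1) - P S k = q * (2 / real n)"
      using that by (simp add: step_magn_mean magn_Suc[OF n_pos] q_def algebra_simps)
    moreover have "q * (2 / real n) \<le> \<rho> * (2 / real n)" using q by (intro mult_right_mono) auto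
    moreover have "0 \<le> q * (2 / real n)" using q by simp
    ultimately show ?thesis by simp
  qed
  from lipschitz_of_adjacent[of n "P S", OF this assms] have "\<bar>P S k - P S l\<bar> \<le> \<rho> * (2 / real n) * \<bar>real k - real l\<bar>" .
  also have "\<dots> = \<rho> * \<bar>S k - S l\<bar>"
    unfolding magn_diff[OF n_pos] abs_mult by simp
  finally show ?thesis .
qed

end

section \<open>Upper bound\<close>

text \<open>The inhomogeneity is written as (1 - r) c so that c is the fixed point.\<close>

lemma affine_recursion_le:
  fixes x :: "nat \<Rightarrow> real"
  assumes step: "\<And>t. x (Suc t) \<le> r * x t + (1 - r) * c" and "0 \<le> r"
  shows "x t \<le> r ^ t * (x 0 - c) + c"
proof (induction t)
  case (Suc t)
  have "x (Suc t) \<le> r * (r ^ t * (x 0 - c) + c) + (1 - r) * c"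
    using step[of t] mult_left_mono[OF Suc \<open>0 \<le> r\<close>] by linarith
  then show ?case by (simp add: algebra_simps)
qed simp

lemma tv_ge_test:
  assumes "\<And>k. k \<le> n \<Longrightarrow> \<bar>f k\<bar> \<le> 1"
  shows "mean n (dist_t n \<beta> k0 t) f - mean n (pi_n n \<beta>) f \<le> 2 * tv_to_stat n \<beta> k0 t"
proof -
  have "mean n (dist_t n \<beta> k0 t) f - mean n (pi_n n \<beta>) f
     = (\<Sum>k=0..n. (dist_t n \<beta> k0 t k - pi_n n \<beta> k) * f k)"
    by (simp add: mean_def left_diff_distrib sum_subtractf)
  also have "\<dots> \<le> (\<Sum>k=0..n. \<bar>dist_t n \<beta> k0 t k - pi_n n \<beta> k\<bar>)"
  proof (rule sum_mono)
    fix k assume "k \<in> {0..n}"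
    then have "\<bar>dist_t n \<beta> k0 t k - pi_n n \<beta> k\<bar> * \<bar>f k\<bar> \<le> \<bar>dist_t n \<beta> k0 t k - pi_n n \<beta> k\<bar>"
      using assms by (intro mult_left_le) auto
    then show "(dist_t n \<beta> k0 t k - pi_n n \<beta> k) * f k \<le> \<bar>dist_t n \<beta> k0 t k - pi_n n \<beta> k\<bar>"
      unfolding abs_mult[symmetric] by linarith
  qed
  finally show ?thesis by (simp add: tv_to_stat_def)
qed

text \<open>The sign of the difference of the two laws attains the dual form of total variation over
  test functions bounded by 1, hence the factor 2.\<close>

lemma tv_eq_test:
  obtains f where "\<And>k. \<bar>f k\<bar> \<le> 1"
    "2 * tv_to_stat n \<beta> k0 t = mean n (dist_t n \<beta> k0 t) f - mean n (pi_n n \<beta>) f"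
proof
  let ?f = "\<lambda>k. sgn (dist_t n \<beta> k0 t k - pi_n n \<beta> k)"
  show "\<bar>?f k\<bar> \<le> 1" for k by (simp add: sgn_if)
  show "2 * tv_to_stat n \<beta> k0 t = mean n (dist_t n \<beta> k0 t) ?f - mean n (pi_n n \<beta>) ?f"
    by (simp add: tv_to_stat_def mean_def abs_sgn left_diff_distrib sum_subtractf)
qed

section \<open>Moments along the chain and total variation after cutoff\<close>

context subcritical
begin

abbreviation "law k0 t \<equiv> dist_t n \<beta> k0 t"
abbreviation "\<pi> \<equiv> pi_n n \<beta>"
abbreviation "v k0 t \<equiv> mean n (law k0 t) (\<lambda>k. (S k)\<^sup>2)"

lemma delta_n_pos: "0 < \<delta> * real n" using delta_pos n_pos by simp

lemma rho_pos: "0 < \<rho>" and rho_nonneg: "0 \<le> \<rho>" and rho_le_1: "\<rho> \<le> 1"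
  using rho_bounds by linarith+

lemma one_minus_rho_square_pos: "0 < 1 - \<rho>\<^sup>2"
  using one_minus_rho_square delta_pos n_pos by (smt (verit) divide_pos_pos of_nat_0_less_iff)

lemma rho_square_ge: "1 - 2 * (\<delta> / real n) \<le> \<rho>\<^sup>2" "1 - 4 * (\<delta> / real n) \<le> (\<rho>\<^sup>2)\<^sup>2"
proof -
  show "1 - 2 * (\<delta> / real n) \<le> \<rho>\<^sup>2" by (simp add: power2_diff)
  show "1 - 4 * (\<delta> / real n) \<le> (\<rho>\<^sup>2)\<^sup>2"
    using Bernoulli_inequality[of "- (\<delta> / real n)" 4] rho_bounds by (simp flip: power_mult)
qed

text \<open>Puts the one-step noise into fixed-point form, so that 4/(\<delta> n) bounds the
  equilibrium level of the recursion with rate \<rho>^2.\<close>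

lemma noise_le: "4 / (real n)\<^sup>2 \<le> (1 - \<rho>\<^sup>2) * (4 / (\<delta> * real n))"
proof -
  have "\<delta> / real n * (4 / (\<delta> * real n)) \<le> (1 - \<rho>\<^sup>2) * (4 / (\<delta> * real n))"
    using delta_n_pos by (intro mult_right_mono one_minus_rho_square) auto
  then show ?thesis using delta_pos by (simp add: power2_eq_square)
qed

lemma step_magn_square_linear:
  assumes "k \<le> n" shows "P (\<lambda>k. (S k)\<^sup>2) k \<le> \<rho>\<^sup>2 * (S k)\<^sup>2 + 4 / (real n)\<^sup>2"
proof -
  have "0 \<le> 2 / real n * (\<beta> ^ 3 * (S k) ^ 4 / 12)" using delta_le_1 by simp
  then have "P (\<lambda>k. (S k)\<^sup>2) k \<le> (1 - 2 * (\<delta> / real n)) * (S k)\<^sup>2 + 4 / (real n)\<^sup>2"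
    using step_magn_square[OF assms] by (simp add: algebra_simps)
  also have "(1 - 2 * (\<delta> / real n)) * (S k)\<^sup>2 \<le> \<rho>\<^sup>2 * (S k)\<^sup>2"
    by (intro mult_right_mono rho_square_ge) auto
  finally show ?thesis by simp
qed

lemma second_moment_linear:
  assumes "k0 \<le> n" shows "v k0 (Suc t) \<le> \<rho>\<^sup>2 * v k0 t + 4 / (real n)\<^sup>2"
proof -
  note p = prob_vec_dist[OF assms, of t]
  have "v k0 (Suc t) \<le> mean n (law k0 t) (\<lambda>k. \<rho>\<^sup>2 * (S k)\<^sup>2 + 4 / (real n)\<^sup>2)"
    unfolding mean_dist_Suc[OF n_pos] by (intro mean_mono p step_magn_square_linear)
  also have "\<dots> = \<rho>\<^sup>2 * v k0 t + 4 / (real n)\<^sup>2"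
    unfolding mean_add mean_cmult mean_const[OF p] ..
  finally show ?thesis .
qed

text \<open>Jensen replaces the fourth moment by the squared second moment, which closes the
  recursion while keeping the nonlinear damping.\<close>

lemma second_moment_step:
  assumes "k0 \<le> n"
  shows "v k0 (Suc t) \<le> v k0 t - 2 / real n * (\<delta> * v k0 t + \<beta> ^ 3 / 12 * (v k0 t)\<^sup>2) + 4 / (real n)\<^sup>2"
proof -
  note p = prob_vec_dist[OF assms, of t]
  have "v k0 (Suc t) \<le> mean n (law k0 t)
     (\<lambda>k. (S k)\<^sup>2 - 2 / real n * (\<delta> * (S k)\<^sup>2 + \<beta> ^ 3 / 12 * (S k) ^ 4) + 4 / (real n)\<^sup>2)"
    unfolding mean_dist_Suc[OF n_pos] using step_magn_square by (intro mean_mono p) simp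
  also have "\<dots> = v k0 t - 2 / real n * (\<delta> * v k0 t + \<beta> ^ 3 / 12 * mean n (law k0 t) (\<lambda>k. (S k) ^ 4)) + 4 / (real n)\<^sup>2"
    unfolding mean_add mean_diff mean_cmult mean_const[OF p] ..
  also have "\<dots> \<le> v k0 t - 2 / real n * (\<delta> * v k0 t + \<beta> ^ 3 / 12 * (v k0 t)\<^sup>2) + 4 / (real n)\<^sup>2"
  proof -
    have "(v k0 t)\<^sup>2 \<le> mean n (law k0 t) (\<lambda>k. (S k) ^ 4)"
      using mean_square_le[OF p, of "\<lambda>k. (S k)\<^sup>2"] by simp
    then have "2 / real n * (\<delta> * v k0 t + \<beta> ^ 3 / 12 * (v k0 t)\<^sup>2)
      \<le> 2 / real n * (\<delta> * v k0 t + \<beta> ^ 3 / 12 * mean n (law k0 t) (\<lambda>k. (S k) ^ 4))"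
      using delta_le_1 by (intro mult_left_mono add_left_mono) auto
    then show ?thesis by linarith
  qed
  finally show ?thesis .
qed

lemma second_moment_decay:
  assumes "k0 \<le> n"
  shows "v k0 (t + m) \<le> (\<rho>\<^sup>2) ^ m * v k0 t + 4 / (\<delta> * real n)"
proof -
  have "v k0 (t + m) \<le> (\<rho>\<^sup>2) ^ m * (v k0 (t + 0) - 4 / (\<delta> * real n)) + 4 / (\<delta> * real n)"
  proof (rule affine_recursion_le)
    show "v k0 (t + Suc m) \<le> \<rho>\<^sup>2 * v k0 (t + m) + (1 - \<rho>\<^sup>2) * (4 / (\<delta> * real n))" for m
      using second_moment_linear[OF assms, of "t + m"] noise_le unfolding add_Suc_right by linarith
  qed simp
  also have "\<dots> \<le> (\<rho>\<^sup>2) ^ m * v k0 t + 4 / (\<delta> * real n)"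
    using delta_n_pos by (auto simp: right_diff_distrib)
  finally show ?thesis .
qed

text \<open>Stationarity makes the second moment equal before and after a step, so the linear
  recursion bounds it by its own fixed point.\<close>

lemma second_moment_pi: "mean n \<pi> (\<lambda>k. (S k)\<^sup>2) \<le> 4 / (\<delta> * real n)"
proof -
  let ?w = "mean n \<pi> (\<lambda>k. (S k)\<^sup>2)"
  have "mean n \<pi> (P (\<lambda>k. (S k)\<^sup>2)) \<le> mean n \<pi> (\<lambda>k. \<rho>\<^sup>2 * (S k)\<^sup>2 + 4 / (real n)\<^sup>2)"
    by (intro mean_mono prob_vec_pi step_magn_square_linear)
  then have "?w \<le> \<rho>\<^sup>2 * ?w + 4 / (real n)\<^sup>2"
    unfolding mean_pi_step[OF n_pos] mean_add mean_cmult mean_const[OF prob_vec_pi] .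
  then have "(1 - \<rho>\<^sup>2) * ?w \<le> (1 - \<rho>\<^sup>2) * (4 / (\<delta> * real n))"
    using noise_le unfolding left_diff_distrib by linarith
  then show ?thesis using one_minus_rho_square_pos by (rule mult_left_le_imp_le)
qed

text \<open>Total variance: the conditional variance adds at most 4/n^2, and the conditional mean
  \<open>P S\<close> is \<rho>-Lipschitz in S. The variance starts at 0, so it never exceeds the
  fixed point.\<close>

lemma variance_bound:
  assumes "k0 \<le> n"
  shows "mean n (law k0 t) (\<lambda>k. (S k)\<^sup>2) - (mean n (law k0 t) S)\<^sup>2 \<le> 4 / (\<delta> * real n)"
proof -
  define V where "V t = v k0 t - (mean n (law k0 t) S)\<^sup>2" for t
  have step: "V (Suc t) \<le> \<rho>\<^sup>2 * V t + (1 - \<rho>\<^sup>2) * (4 / (\<delta> * real n))" for t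
  proof -
    note p = prob_vec_dist[OF assms, of t]
    have "v k0 (Suc t) \<le> mean n (law k0 t) (\<lambda>k. (P S k)\<^sup>2 + 4 / (real n)\<^sup>2)"
      unfolding mean_dist_Suc[OF n_pos] by (intro mean_mono p step_magn_variance)
    also have "\<dots> = mean n (law k0 t) (\<lambda>k. (P S k)\<^sup>2) + 4 / (real n)\<^sup>2"
      unfolding mean_add mean_const[OF p] ..
    finally have "V (Suc t) \<le> mean n (law k0 t) (\<lambda>k. (P S k)\<^sup>2) - (mean n (law k0 t) (P S))\<^sup>2 + 4 / (real n)\<^sup>2"
      unfolding V_def mean_dist_Suc[OF n_pos] by linarith
    also have "mean n (law k0 t) (\<lambda>k. (P S k)\<^sup>2) - (mean n (law k0 t) (P S))\<^sup>2 \<le> \<rho>\<^sup>2 * V t"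
      unfolding V_def by (rule variance_lipschitz[OF p]) (rule step_magn_lipschitz)
    finally show ?thesis using noise_le by linarith
  qed
  have "V 0 = 0" unfolding V_def mean_dist_0[OF assms] by simp
  then have "V t \<le> (\<rho>\<^sup>2) ^ t * (0 - 4 / (\<delta> * real n)) + 4 / (\<delta> * real n)"
    using affine_recursion_le[of V "\<rho>\<^sup>2" "4 / (\<delta> * real n)" t, OF step] by simp
  moreover have "0 \<le> (\<rho>\<^sup>2) ^ t * (4 / (\<delta> * real n))" using delta_n_pos by (intro mult_nonneg_nonneg) auto
  ultimately have "V t \<le> 4 / (\<delta> * real n)" by simp
  then show ?thesis by (simp add: V_def)
qed

text \<open>For \<delta> > 1/2 the bound v <= 1 suffices. Otherwise \<beta> >= 1/2 and \<beta>^3/12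
  >= 1/96, so quadratic damping brings v below 2\<delta> from any start, where it stays.\<close>

lemma second_moment_after_burn_in:
  assumes k0: "k0 \<le> n" and large: "384 \<le> \<delta>\<^sup>2 * real n" and T: "96 * (real n / \<delta>) \<le> real T"
  shows "v k0 T \<le> 2 * \<delta>"
proof (cases "\<delta> \<le> 1 / 2")
  case False
  have "v k0 T \<le> mean n (law k0 T) (\<lambda>_. 1)"
    using magn_bounds by (intro mean_mono prob_vec_dist k0) (auto simp: abs_square_le_1 abs_le_iff minus_le_iff)
  then show ?thesis using False mean_const[OF prob_vec_dist[OF k0]] by simp
next
  case True
  have v0: "0 \<le> v k0 t" for t by (intro mean_nonneg prob_vec_dist k0) auto
  \<comment> \<open>At level 2\<delta> the linear damping removes 4 \<delta>^2/n, which exceeds the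
    noise 4/n^2 because \<delta>^2 n >= 1.\<close>
  have stay: "v k0 (Suc t) \<le> 2 * \<delta>" if "v k0 t \<le> 2 * \<delta>" for t
  proof -
    have "0 \<le> 2 / real n * (\<beta> ^ 3 / 12 * (v k0 t)\<^sup>2)" using delta_le_1 by simp
    then have "v k0 (Suc t) \<le> (1 - 2 * (\<delta> / real n)) * v k0 t + 4 / (real n)\<^sup>2"
      using second_moment_step[OF k0, of t] by (simp add: algebra_simps)
    also have "(1 - 2 * (\<delta> / real n)) * v k0 t \<le> (1 - 2 * (\<delta> / real n)) * (2 * \<delta>)"
      using that by (rule mult_left_mono) (use rho_bounds in linarith)
    also have "\<dots> = 2 * \<delta> - 4 * (\<delta>\<^sup>2 * real n) / (real n)\<^sup>2"
      using n_pos by (simp add: field_simps power2_eq_square)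
    also have "4 / (real n)\<^sup>2 \<le> 4 * (\<delta>\<^sup>2 * real n) / (real n)\<^sup>2"
      using large by (intro divide_right_mono) auto
    finally show ?thesis by simp
  qed
  show ?thesis
  proof (rule ccontr)
    assume *: "\<not> v k0 T \<le> 2 * \<delta>"
    have big: "2 * \<delta> < v k0 t" if "t \<le> T" for t
    proof (rule ccontr)
      assume "\<not> 2 * \<delta> < v k0 t"
      then have "v k0 (t + m) \<le> 2 * \<delta>" for m
        by (induction m) (use stay in \<open>auto\<close>)
      from this[of "T - t"] show False using that * by simp
    qed
    \<comment> \<open>A discrete form of v' = - v^2/(96 n): above level 2\<delta> the reciprocal of
      v grows by at least 1/(96 n) per step.\<close>
    have "real t / (96 * real n) \<le> 1 / v k0 t" if "t \<le> T" for t
      using that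
    proof (induction t)
      case 0
      then show ?case using v0[of 0] by (simp)
    next
      case (Suc t)
      define w where "w = v k0 t"
      have w: "2 * \<delta> < w" "0 < w" using big[of t] Suc.prems delta_pos by (auto simp: w_def)
      have w': "0 < v k0 (Suc t)" using big[OF Suc.prems] delta_pos by linarith
      have "(1 / 2) ^ 3 \<le> \<beta> ^ 3" using True by (intro power_mono) auto
      then have \<beta>: "1 / 96 \<le> \<beta> ^ 3 / 12" by (simp add: power3_eq_cube)
      have "1 / 96 * w\<^sup>2 \<le> \<delta> * w + \<beta> ^ 3 / 12 * w\<^sup>2"
      proof -
        have "0 \<le> \<delta> * w" using w delta_pos by simp
        then show ?thesis using mult_right_mono[OF \<beta>, of "w\<^sup>2"] zero_le_power2[of w] by linarith
      qed
      then have "2 / real n * (1 / 96 * w\<^sup>2) \<le> 2 / real n * (\<delta> * w + \<beta> ^ 3 / 12 * w\<^sup>2)"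
        by (intro mult_left_mono) auto
      then have "v k0 (Suc t) \<le> w - 2 / real n * (1 / 96 * w\<^sup>2) + 4 / (real n)\<^sup>2"
        using second_moment_step[OF k0, of t] unfolding w_def[symmetric] by linarith
      \<comment> \<open>Since w > \<delta>, the threshold 384 = 4 * 96 makes the noise at most half
        of the quadratic damping w^2/(48 n).\<close>
      moreover have "4 / (real n)\<^sup>2 \<le> w\<^sup>2 / (96 * real n)"
      proof -
        have "\<delta>\<^sup>2 \<le> w\<^sup>2" using w delta_pos by (intro power_mono) auto
        then have "384 \<le> w\<^sup>2 * real n" using large by (smt (verit) mult_right_mono of_nat_0_le_iff)
        then have "384 / (96 * (real n)\<^sup>2) \<le> w\<^sup>2 * real n / (96 * (real n)\<^sup>2)" by (intro divide_right_mono) auto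
        then show ?thesis using n_pos by (simp add: power2_eq_square)
      qed
      ultimately have le: "v k0 (Suc t) \<le> w - w\<^sup>2 / (96 * real n)" by simp
      define y where "y = w / (96 * real n)"
      have y: "0 < y" using w n_pos by (simp add: y_def)
      have le': "v k0 (Suc t) \<le> w * (1 - y)" using le by (simp add: y_def power2_eq_square algebra_simps)
      \<comment> \<open>(1 - y)(1 + y) <= 1 turns the multiplicative decrease into an additive
        increase of the reciprocal.\<close>
      have "v k0 (Suc t) * (1 + y) \<le> w * (1 - y) * (1 + y)" using le' y by (intro mult_right_mono) auto
      also have "\<dots> \<le> w" using w by (simp add: algebra_simps)
      finally have "(1 + y) / w \<le> 1 / v k0 (Suc t)" using w w' by (simp add: field_simps)
      moreover have "(1 + y) / w = 1 / w + 1 / (96 * real n)"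
        using w n_pos by (simp add: y_def field_simps)
      ultimately show ?case using Suc by (simp add: w_def add_divide_distrib)
    qed
    from this[of T] have "real T / (96 * real n) \<le> 1 / v k0 T" by simp
    moreover have "1 / \<delta> \<le> real T / (96 * real n)"
      using T n_pos delta_pos by (simp add: field_simps)
    ultimately have "1 / \<delta> \<le> 1 / v k0 T" by linarith
    then have "v k0 T \<le> \<delta>" using big[of T] delta_pos by (simp add: field_simps)
    then show False using * delta_pos by linarith
  qed
qed

text \<open>The t linear steps multiply 2\<delta> by at most exp(-2 t \<delta>/n) <= 1/(\<delta>^2
  n), leaving 2/(\<delta> n) besides the noise level 4/(\<delta> n).\<close>

lemma second_moment_at_cutoff:
  assumes k0: "k0 \<le> n" and large: "384 \<le> \<delta>\<^sup>2 * real n" and T: "96 * (real n / \<delta>) \<le> real T"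
    and t: "1 / 2 * (real n / \<delta>) * ln (\<delta>\<^sup>2 * real n) \<le> real t"
  shows "v k0 (T + t) \<le> 6 / (\<delta> * real n)"
proof -
  have "\<rho> \<le> exp (- (\<delta> / real n))" using exp_ge_add_one_self[of "- (\<delta> / real n)"] by simp
  then have "\<rho> ^ (2 * t) \<le> exp (- (\<delta> / real n)) ^ (2 * t)"
    by (intro power_mono rho_nonneg)
  also have "\<dots> = exp (- (2 * real t * (\<delta> / real n)))"
    by (simp flip: exp_of_nat_mult)
  also have "\<dots> \<le> exp (- ln (\<delta>\<^sup>2 * real n))"
    using t n_pos delta_pos by (simp add: field_simps)
  also have "\<dots> = 1 / (\<delta>\<^sup>2 * real n)"
    using large by (simp add: exp_minus inverse_eq_divide)
  finally have "(\<rho>\<^sup>2) ^ t \<le> 1 / (\<delta>\<^sup>2 * real n)" by (simp add: power_mult)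
  then have "(\<rho>\<^sup>2) ^ t * v k0 T \<le> 1 / (\<delta>\<^sup>2 * real n) * (2 * \<delta>)"
    using second_moment_after_burn_in[OF k0 large T] large
    by (intro mult_mono mean_nonneg prob_vec_dist k0) auto
  also have "\<dots> = 2 / (\<delta> * real n)" using delta_pos by (simp add: power2_eq_square)
  finally show ?thesis using second_moment_decay[OF k0, of T t] by (simp add: add_divide_distrib[symmetric])
qed

lemma mean_abs_le:
  assumes "prob_vec n p" "mean n p (\<lambda>k. (S k)\<^sup>2) \<le> c"
  shows "mean n p (\<lambda>k. \<bar>S k\<bar>) \<le> sqrt c"
proof -
  have "(mean n p (\<lambda>k. \<bar>S k\<bar>))\<^sup>2 \<le> c"
    using mean_square_le[OF assms(1), of "\<lambda>k. \<bar>S k\<bar>"] assms(2) by simp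
  then show ?thesis by (rule real_le_rsqrt)
qed

text \<open>Under the product of the law at time t and \<open>\<pi>\<close>, two states differ by at
  most n/2 (|S k| + |S l|) positions, and the smoothed test function changes by at most sqrt A per
  position. Second moments bound both expectations.\<close>

lemma tv_smoothing:
  assumes k0: "k0 \<le> n" and c: "v k0 t \<le> c" "mean n \<pi> (\<lambda>k. (S k)\<^sup>2) \<le> c"
  shows "(tv_to_stat n \<beta> k0 (t + m))\<^sup>2 \<le> 48 * (real n)\<^sup>2 * c * (2 / real (Suc m) + 3072 / (real n)\<^sup>2)"
proof -
  obtain f where f: "\<And>k. \<bar>f k\<bar> \<le> 1"
    and tv: "2 * tv_to_stat n \<beta> k0 (t + m) = mean n (law k0 (t + m)) f - mean n \<pi> f"
    using tv_eq_test[of n \<beta> k0 "t + m"] by blast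
  define F where "F = (P ^^ m) f"
  \<comment> \<open>\<open>gradient_bound\<close> with \<alpha> = 1/24 and b = 2/n: 192 is
    8/\<alpha> and 3072/n^2 is 32 b^2/\<alpha>.\<close>
  define A where "A = 192 * (2 / real (Suc m) + 3072 / (real n)\<^sup>2)"
  have A: "0 \<le> A" by (simp add: A_def)
  have adj: "\<bar>F (k + 1) - F k\<bar> \<le> sqrt A" if "k < n" for k
  proof -
    have "(grad F k)\<^sup>2 \<le> A"
      using gradient_bound[of f k m, OF f that] by (simp add: F_def A_def power_divide)
    then show ?thesis using real_sqrt_le_mono[of "(grad F k)\<^sup>2" A] by (simp add: grad_def)
  qed
  have F: "F k - F l \<le> sqrt A * (real n / 2) * (\<bar>S k\<bar> + \<bar>S l\<bar>)" if "k \<le> n" "l \<le> n" for k l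
  proof -
    have "F k - F l \<le> sqrt A * \<bar>real k - real l\<bar>"
      using lipschitz_of_adjacent[of n F, OF adj that] by linarith
    also have "\<bar>real k - real l\<bar> = real n / 2 * \<bar>S k - S l\<bar>"
      unfolding magn_diff[OF n_pos] abs_mult using n_pos by simp
    also have "sqrt A * (real n / 2 * \<bar>S k - S l\<bar>) \<le> sqrt A * (real n / 2 * (\<bar>S k\<bar> + \<bar>S l\<bar>))"
      using A by (intro mult_left_mono) auto
    finally show ?thesis by (simp only: mult.assoc)
  qed
  note p = prob_vec_dist[OF k0, of t]
  have c0: "0 \<le> c" using c(1) mean_nonneg[OF p, of "\<lambda>k. (S k)\<^sup>2"] by simp
  have "2 * tv_to_stat n \<beta> k0 (t + m) = mean n (law k0 t) F - mean n \<pi> F"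
    unfolding tv mean_dist_add[OF n_pos] F_def mean_pi_iter[OF n_pos] ..
  also have "\<dots> = mean n (law k0 t) (\<lambda>k. mean n \<pi> (\<lambda>l. F k - F l))"
    unfolding mean_diff mean_const[OF prob_vec_pi] mean_const[OF p] ..
  also have "\<dots> \<le> mean n (law k0 t) (\<lambda>k. mean n \<pi> (\<lambda>l. sqrt A * (real n / 2) * (\<bar>S k\<bar> + \<bar>S l\<bar>)))"
    by (intro mean_mono p prob_vec_pi F)
  also have "\<dots> = sqrt A * (real n / 2) * (mean n (law k0 t) (\<lambda>k. \<bar>S k\<bar>) + mean n \<pi> (\<lambda>k. \<bar>S k\<bar>))"
    unfolding mean_cmult mean_add mean_const[OF prob_vec_pi] mean_const[OF p] ..
  also have "\<dots> \<le> sqrt A * (real n / 2) * (sqrt c + sqrt c)"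
    using A by (intro mult_left_mono add_mono mean_abs_le p prob_vec_pi c) auto
  finally have "tv_to_stat n \<beta> k0 (t + m) \<le> sqrt A * (real n / 2) * sqrt c" by simp
  moreover have "0 \<le> tv_to_stat n \<beta> k0 (t + m)" by (simp add: tv_to_stat_def sum_nonneg)
  ultimately have "(tv_to_stat n \<beta> k0 (t + m))\<^sup>2 \<le> (sqrt A * (real n / 2) * sqrt c)\<^sup>2"
    by (intro power_mono)
  also have "\<dots> = A * (real n)\<^sup>2 * c / 4" using A c0 by (simp add: power_mult_distrib power_divide)
  also have "\<dots> = 48 * (real n)\<^sup>2 * c * (2 / real (Suc m) + 3072 / (real n)\<^sup>2)"
    by (simp add: A_def)
  finally show ?thesis .
qed

text \<open>The time splits into burn-in T, linear decay t and smoothing m. With a = n/\<delta> >=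
  1, the 98 is the 96 of the burn-in plus 2 for rounding, so m + 1 >= (\<gamma> - 98) a.\<close>

lemma d_n_after_cutoff:
  assumes large: "384 \<le> \<delta>\<^sup>2 * real n" and \<gamma>: "100 \<le> \<gamma>"
  shows "(d_n_real n \<beta> (1 / 2 * (real n / \<delta>) * ln (\<delta>\<^sup>2 * real n) + \<gamma> * (real n / \<delta>)))\<^sup>2
    \<le> 576 / (\<gamma> - 98) + 884736 / (\<delta> * real n)"
proof -
  define a where "a = real n / \<delta>"
  define r where "r = 1 / 2 * a * ln (\<delta>\<^sup>2 * real n)"
  define N T t where "N = nat \<lfloor>r + \<gamma> * a\<rfloor>" and "T = nat \<lceil>96 * a\<rceil>" and "t = nat \<lceil>r\<rceil>"
  have "real n * 1 \<ge> 1 * \<delta>" using delta_le_1 delta_pos n_ge_2 by (intro mult_mono) auto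
  then have a: "1 \<le> a" using delta_pos by (simp add: a_def)
  have r: "0 \<le> r" using a large by (simp add: r_def)
  have ga: "100 * a \<le> \<gamma> * a" using \<gamma> a by (intro mult_right_mono) auto
  have N: "r + \<gamma> * a - 1 \<le> real N" using r a ga unfolding N_def by linarith
  have T: "96 * a \<le> real T" "real T \<le> 96 * a + 1" using a unfolding T_def by linarith+
  have t: "r \<le> real t" "real t \<le> r + 1" using r unfolding t_def by linarith+
  define m where "m = N - (T + t)"
  have "real (T + t) \<le> real N" unfolding of_nat_add using N T t ga a by linarith
  then have m: "N = T + t + m" by (simp add: m_def)
  have "(\<gamma> - 98) * a \<le> real (Suc m)"
  proof -
    have "r + \<gamma> * a - 1 \<le> real T + real t + real m" using N m by simp
    then show ?thesis using T t a by (simp add: left_diff_distrib)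
  qed
  moreover have "0 < (\<gamma> - 98) * a" using \<gamma> a by simp
  ultimately have "2 / real (Suc m) \<le> 2 / ((\<gamma> - 98) * a)" by (intro divide_left_mono) auto
  then have m': "2 / real (Suc m) + 3072 / (real n)\<^sup>2 \<le> 2 / ((\<gamma> - 98) * a) + 3072 / (real n)\<^sup>2" by simp
  have tv: "(tv_to_stat n \<beta> k0 N)\<^sup>2 \<le> 576 / (\<gamma> - 98) + 884736 / (\<delta> * real n)" if k0: "k0 \<le> n" for k0
  proof -
    have "v k0 (T + t) \<le> 6 / (\<delta> * real n)"
      using T t by (intro second_moment_at_cutoff k0 large) (auto simp: a_def r_def)
    moreover have "mean n \<pi> (\<lambda>k. (S k)\<^sup>2) \<le> 6 / (\<delta> * real n)"
      by (rule order_trans[OF second_moment_pi]) (use delta_n_pos in \<open>simp add: divide_right_mono\<close>)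
    ultimately have "(tv_to_stat n \<beta> k0 N)\<^sup>2
        \<le> 48 * (real n)\<^sup>2 * (6 / (\<delta> * real n)) * (2 / real (Suc m) + 3072 / (real n)\<^sup>2)"
      unfolding m by (rule tv_smoothing[OF k0])
    also have "\<dots> \<le> 48 * (real n)\<^sup>2 * (6 / (\<delta> * real n)) * (2 / ((\<gamma> - 98) * a) + 3072 / (real n)\<^sup>2)"
      using delta_n_pos by (intro mult_left_mono m') auto
    also have "48 * (real n)\<^sup>2 * (6 / (\<delta> * real n)) = 288 * a"
      using n_pos by (simp add: a_def power2_eq_square)
    also have "288 * a * (2 / ((\<gamma> - 98) * a) + 3072 / (real n)\<^sup>2) = 576 / (\<gamma> - 98) + 884736 * (a / (real n)\<^sup>2)"
      using a by (simp add: distrib_left)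
    also have "a / (real n)\<^sup>2 = 1 / (\<delta> * real n)" using n_pos by (simp add: a_def power2_eq_square)
    finally show ?thesis by simp
  qed
  have "d_n n \<beta> N \<in> (\<lambda>k0. tv_to_stat n \<beta> k0 N) ` {0..n}"
    unfolding d_n_def by (rule Max_in) auto
  then obtain k0 where "k0 \<le> n" "d_n n \<beta> N = tv_to_stat n \<beta> k0 N" by auto
  then show ?thesis using tv[of k0] by (simp add: d_n_real_def N_def r_def a_def)
qed

end

section \<open>Lower bound\<close>

lemma power3_add_le:
  fixes a h :: real assumes "0 \<le> a" "0 \<le> h" shows "(a + h) ^ 3 \<le> 4 * (a ^ 3 + h ^ 3)"
proof -
  have "0 \<le> 3 * (a + h) * (a - h)\<^sup>2" using assms by simp
  also have "\<dots> = 4 * (a ^ 3 + h ^ 3) - (a + h) ^ 3"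
    by (simp add: power2_eq_square power3_eq_cube algebra_simps)
  finally show ?thesis by simp
qed

text \<open>AM-GM on |s| at scale x, times s^2: absolute third moments reduce to even ones, for
  which recursions are available.\<close>

lemma abs_power3_le:
  fixes s x :: real assumes "0 < x" shows "\<bar>s\<bar> ^ 3 \<le> x / 2 * s\<^sup>2 + s ^ 4 / (2 * x)"
proof -
  have "0 \<le> s\<^sup>2 * (\<bar>s\<bar> - x)\<^sup>2 / (2 * x)" using assms by simp
  also have "s\<^sup>2 * (\<bar>s\<bar> - x)\<^sup>2 = s ^ 4 - 2 * x * \<bar>s\<bar> ^ 3 + x\<^sup>2 * s\<^sup>2"
  proof -
    have "\<bar>s\<bar>\<^sup>2 * (\<bar>s\<bar> - x)\<^sup>2 = \<bar>s\<bar> ^ 4 - 2 * x * \<bar>s\<bar> ^ 3 + x\<^sup>2 * \<bar>s\<bar>\<^sup>2"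
      by (simp only: power2_eq_square power3_eq_cube power4_eq_xxxx) (simp only: algebra_simps)
    then show ?thesis by simp
  qed
  also have "(s ^ 4 - 2 * x * \<bar>s\<bar> ^ 3 + x\<^sup>2 * s\<^sup>2) / (2 * x) = x / 2 * s\<^sup>2 + s ^ 4 / (2 * x) - \<bar>s\<bar> ^ 3"
    using assms by (simp add: add_divide_distrib diff_divide_distrib power2_eq_square)
  finally show ?thesis by simp
qed

context subcritical
begin

text \<open>\<open>y\<close> solves \<open>y (Suc t) = \<rho>\<^sup>2 y t + 4/n\<^sup>2\<close> with \<open>y 0 = (S k0)\<^sup>2\<close>; with this choice the recursion
  for the fourth moment is dominated by the square of the one for the second.\<close>

lemma moments_bound:
  assumes k0: "k0 \<le> n"
  defines "c \<equiv> 4 / (real n)\<^sup>2 / (1 - \<rho>\<^sup>2)"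
  defines "y \<equiv> \<lambda>t. (\<rho>\<^sup>2) ^ t * ((S k0)\<^sup>2 - c) + c"
  shows "v k0 t \<le> y t" "mean n (law k0 t) (\<lambda>k. (S k) ^ 4) \<le> 12 * (y t)\<^sup>2"
proof -
  have c: "(1 - \<rho>\<^sup>2) * c = 4 / (real n)\<^sup>2"
  proof -
    have "q * (a / q) = a" if "0 < q" for a q :: real using that by simp
    then show ?thesis unfolding c_def using one_minus_rho_square_pos by blast
  qed
  have v: "v k0 t \<le> y t" for t
    using affine_recursion_le[of "\<lambda>t. v k0 t" "\<rho>\<^sup>2" c t] second_moment_linear[OF k0]
    unfolding c y_def by (simp add: mean_dist_0[OF k0])
  show "v k0 t \<le> y t" by (rule v)
  have y0: "0 \<le> y t" for t
    using v[of t] mean_nonneg[OF prob_vec_dist[OF k0, of t], of "\<lambda>k. (S k)\<^sup>2"] by simp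
  have ySuc: "y (Suc t) = \<rho>\<^sup>2 * y t + 4 / (real n)\<^sup>2" for t
    unfolding c[symmetric] y_def by (simp add: algebra_simps)
  show "mean n (law k0 t) (\<lambda>k. (S k) ^ 4) \<le> 12 * (y t)\<^sup>2"
  proof (induction t)
    case 0
    show ?case by (simp add: mean_dist_0[OF k0] y_def)
  next
    case (Suc t)
    note p = prob_vec_dist[OF k0, of t]
    let ?w = "mean n (law k0 t) (\<lambda>k. (S k) ^ 4)"
    have w0: "0 \<le> ?w" by (intro mean_nonneg p) auto
    define q h where "q = \<rho>\<^sup>2" and "h = 1 / (real n)\<^sup>2"
    have h: "0 \<le> h" by (simp add: h_def)
    have q: "1 / 4 \<le> q" using power_mono[OF rho_bounds(1), of 2] by (simp add: q_def power_divide)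
    have "mean n (law k0 (Suc t)) (\<lambda>k. (S k) ^ 4)
      \<le> mean n (law k0 t) (\<lambda>k. (1 - 4 * (\<delta> / real n)) * (S k) ^ 4 + 24 / (real n)\<^sup>2 * (S k)\<^sup>2 + 16 / (real n) ^ 4)"
      unfolding mean_dist_Suc[OF n_pos] by (intro mean_mono p step_magn_fourth)
    also have "\<dots> = (1 - 4 * (\<delta> / real n)) * ?w + 24 / (real n)\<^sup>2 * v k0 t + 16 / (real n) ^ 4"
      unfolding mean_add mean_cmult mean_const[OF p] ..
    also have "\<dots> \<le> q\<^sup>2 * (12 * (y t)\<^sup>2) + 24 * h * y t + 16 * h\<^sup>2"
    proof (intro add_mono)
      show "(1 - 4 * (\<delta> / real n)) * ?w \<le> q\<^sup>2 * (12 * (y t)\<^sup>2)"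
        unfolding q_def using rho_square_ge(2) Suc w0 by (intro mult_mono) auto
      show "24 / (real n)\<^sup>2 * v k0 t \<le> 24 * h * y t"
        using v[of t] by (simp add: h_def divide_right_mono)
      show "16 / (real n) ^ 4 \<le> 16 * h\<^sup>2" by (simp add: h_def power_divide flip: power_mult)
    qed
    \<comment> \<open>The factor 12 makes the cross term 96 q h y on the right, which dominates 24 h
      y because q >= 1/4.\<close>
    also have "\<dots> \<le> 12 * (q * y t + 4 * h)\<^sup>2"
    proof -
      have "24 * (h * y t) \<le> 96 * q * (h * y t)" using q h y0[of t] by (intro mult_right_mono) auto
      moreover have "12 * (q * y t + 4 * h)\<^sup>2 = q\<^sup>2 * (12 * (y t)\<^sup>2) + 96 * q * (h * y t) + 192 * h\<^sup>2"
        by (simp add: power2_eq_square algebra_simps)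
      ultimately show ?thesis using zero_le_power2[of h] unfolding mult.assoc by linarith
    qed
    also have "q * y t + 4 * h = y (Suc t)" by (simp add: ySuc q_def h_def)
    finally show ?case .
  qed
qed

text \<open>While the linear trajectory x satisfies x^2 >= 4/(\<delta> n), moments are at most of
  the order of powers of x, so each step loses at most 34 x^3/n beyond the factor \<rho>. With (S
  k0)^2 <= \<delta>/144 the total loss is at most 68/144 of x.\<close>

lemma mean_magn_lower:
  assumes k0: "k0 \<le> n" and s0: "0 < S k0" "(S k0)\<^sup>2 \<le> \<delta> / 144"
    and far: "4 / (\<delta> * real n) \<le> (\<rho> ^ t * S k0)\<^sup>2"
  shows "\<rho> ^ t * S k0 / 2 \<le> mean n (law k0 t) S"
proof -
  define x where "x t = \<rho> ^ t * S k0" for t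
  have x0: "0 < x j" for j using rho_pos s0 by (simp only: x_def mult_pos_pos zero_less_power)
  have xSuc: "x (Suc j) = \<rho> * x j" for j by (simp add: x_def)
  have x1: "x j \<le> 1" for j
  proof -
    have "\<rho> ^ j * S k0 \<le> 1 * 1"
      using s0 magn_bounds[OF k0] by (intro mult_mono power_le_one rho_nonneg rho_le_1) auto
    then show ?thesis by (simp add: x_def)
  qed
  have step: "\<rho> * mean n (law k0 j) S - 34 / real n * x j ^ 3 \<le> mean n (law k0 (Suc j)) S"
    if far: "4 / (\<delta> * real n) \<le> (x j)\<^sup>2" for j
  proof -
    note p = prob_vec_dist[OF k0, of j]
    define y h where "y = x j" and "h = 1 / real n"
    have y: "0 < y" "y \<le> 1" "4 / (\<delta> * real n) \<le> y\<^sup>2" using x0 x1 far by (auto simp: y_def)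
    have h0: "0 \<le> h" by (simp add: h_def)
    have hy: "h \<le> y\<^sup>2 / 4"
    proof -
      have "4 / real n \<le> 4 / (\<delta> * real n)" using delta_n_pos delta_le_1 n_pos by (intro divide_left_mono) auto
      then show ?thesis using y by (simp add: h_def)
    qed
    have m2: "v k0 j \<le> 2 * y\<^sup>2" and m4: "mean n (law k0 j) (\<lambda>k. (S k) ^ 4) \<le> 48 * y ^ 4"
    proof -
      \<comment> \<open>c is the noise level of the second-moment recursion; \<open>far\<close> puts
        it below y^2, so the dominating sequence z is at most 2 y^2.\<close>
      define c where "c = 4 / (real n)\<^sup>2 / (1 - \<rho>\<^sup>2)"
      have "4 / (real n)\<^sup>2 \<le> 4 / (\<delta> * real n) * (1 - \<rho>\<^sup>2)"
        using noise_le by (simp only: mult.commute)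
      then have "c \<le> 4 / (\<delta> * real n)"
        unfolding c_def by (simp only: pos_divide_le_eq one_minus_rho_square_pos)
      then have c: "0 \<le> c" "c \<le> y\<^sup>2"
        using one_minus_rho_square_pos y by (auto simp: c_def)
      define z where "z = (\<rho>\<^sup>2) ^ j * ((S k0)\<^sup>2 - c) + c"
      have "z \<le> (\<rho>\<^sup>2) ^ j * (S k0)\<^sup>2 + c" using c by (simp add: z_def right_diff_distrib)
      also have "(\<rho>\<^sup>2) ^ j * (S k0)\<^sup>2 = y\<^sup>2"
        by (simp only: y_def x_def power_mult_distrib power_mult[symmetric] mult.commute)
      finally have z: "z \<le> 2 * y\<^sup>2" using c by simp
      have "v k0 j \<le> z" using moments_bound(1)[OF k0] unfolding z_def c_def .
      then show "v k0 j \<le> 2 * y\<^sup>2" using z by linarith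
      have "0 \<le> z" using \<open>v k0 j \<le> z\<close> mean_nonneg[OF p, of "\<lambda>k. (S k)\<^sup>2"] by simp
      then have "z\<^sup>2 \<le> (2 * y\<^sup>2)\<^sup>2" using z by (intro power_mono)
      moreover have "mean n (law k0 j) (\<lambda>k. (S k) ^ 4) \<le> 12 * z\<^sup>2"
        using moments_bound(2)[OF k0] unfolding z_def c_def .
      ultimately show "mean n (law k0 j) (\<lambda>k. (S k) ^ 4) \<le> 48 * y ^ 4"
        by (simp add: power_mult_distrib flip: power_mult)
    qed
    define C where "C = y ^ 3 / 8 + y ^ 3 / 48"
    \<comment> \<open>The drift error is bounded by an even polynomial in S at scale y; its
      expectation involves only the two moments just bounded. The 19/24 is 1/8 + 2/3.\<close>
    have pw: "\<bar>S k\<bar> / real n + (\<bar>S k\<bar> + 1 / real n) ^ 3 / 3 \<le> C + 19 / 24 * y * (S k)\<^sup>2 + 2 / (3 * y) * (S k) ^ 4" for k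
    proof -
      define s where "s = S k"
      have "2 * y * \<bar>s\<bar> \<le> y\<^sup>2 + s\<^sup>2" using sum_squares_bound[of y "\<bar>s\<bar>"] by simp
      then have "y * (2 * y * \<bar>s\<bar>) \<le> y * (y\<^sup>2 + s\<^sup>2)" using y by (intro mult_left_mono) auto
      then have "y\<^sup>2 * \<bar>s\<bar> \<le> y ^ 3 / 2 + y * s\<^sup>2 / 2" by (simp add: power2_eq_square power3_eq_cube algebra_simps)
      moreover have "\<bar>s\<bar> * h \<le> \<bar>s\<bar> * (y\<^sup>2 / 4)" using hy by (intro mult_left_mono) auto
      ultimately have 1: "\<bar>s\<bar> * h \<le> y ^ 3 / 8 + y * s\<^sup>2 / 8" by (simp add: mult.commute)
      have "h ^ 3 \<le> (y\<^sup>2 / 4) ^ 3" using hy h0 by (intro power_mono)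
      also have "\<dots> = y ^ 3 * y ^ 3 / 64" by (simp add: power_divide flip: power_mult power_add)
      also have "y ^ 3 * y ^ 3 \<le> y ^ 3" using y by (intro mult_left_le power_le_one) auto
      finally have h3: "h ^ 3 \<le> y ^ 3 / 64" by simp
      have "(\<bar>s\<bar> + h) ^ 3 \<le> 4 * (\<bar>s\<bar> ^ 3 + h ^ 3)" using h0 by (intro power3_add_le) auto
      moreover have "\<bar>s\<bar> ^ 3 \<le> y * s\<^sup>2 / 2 + s ^ 4 / (2 * y)" using abs_power3_le[OF y(1), of s] by simp
      ultimately have "(\<bar>s\<bar> + h) ^ 3 \<le> 2 * (y * s\<^sup>2) + 2 * (s ^ 4 / y) + y ^ 3 / 16"
        using h3 by simp
      then have "(\<bar>s\<bar> + h) ^ 3 / 3 \<le> 2 / 3 * (y * s\<^sup>2) + 2 / 3 * (s ^ 4 / y) + y ^ 3 / 48" by simp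
      then show ?thesis using 1 by (simp add: s_def h_def C_def)
    qed
    have "mean n (law k0 j) (\<lambda>k. C + 19 / 24 * y * (S k)\<^sup>2 + 2 / (3 * y) * (S k) ^ 4)
      = C + 19 / 24 * y * v k0 j + 2 / (3 * y) * mean n (law k0 j) (\<lambda>k. (S k) ^ 4)"
      unfolding mean_add mean_cmult mean_const[OF p] ..
    also have "\<dots> \<le> C + 19 / 24 * y * (2 * y\<^sup>2) + 2 / (3 * y) * (48 * y ^ 4)"
      using y by (intro add_mono mult_left_mono m2 m4) auto
    \<comment> \<open>7/48 + 19/12 + 32 is just below 34.\<close>
    also have "\<dots> \<le> 34 * y ^ 3"
      using y by (simp add: C_def power2_eq_square power3_eq_cube power4_eq_xxxx)
    finally have E3: "mean n (law k0 j) (\<lambda>k. C + 19 / 24 * y * (S k)\<^sup>2 + 2 / (3 * y) * (S k) ^ 4) \<le> 34 * y ^ 3" .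
    have "\<rho> * mean n (law k0 j) S - 1 / real n * mean n (law k0 j) (\<lambda>k. C + 19 / 24 * y * (S k)\<^sup>2 + 2 / (3 * y) * (S k) ^ 4)
      = mean n (law k0 j) (\<lambda>k. \<rho> * S k - 1 / real n * (C + 19 / 24 * y * (S k)\<^sup>2 + 2 / (3 * y) * (S k) ^ 4))"
      unfolding mean_diff mean_cmult[of n _ "1 / real n"] mean_cmult[of n _ \<rho>] ..
    also have "\<dots> \<le> mean n (law k0 j) (P S)"
    proof (intro mean_mono p)
      fix k assume k: "k \<le> n"
      have "- \<delta> * S k - (C + 19 / 24 * y * (S k)\<^sup>2 + 2 / (3 * y) * (S k) ^ 4) \<le> 2 * (u k - d k)"
        using drift_lower[OF k] pw[of k] by linarith
      then have "1 / real n * (- \<delta> * S k - (C + 19 / 24 * y * (S k)\<^sup>2 + 2 / (3 * y) * (S k) ^ 4))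
        \<le> 1 / real n * (2 * (u k - d k))" by (intro mult_left_mono) auto
      moreover have "1 / real n * (2 * (u k - d k)) = 2 / real n * (u k - d k)" by simp
      moreover have "1 / real n * (- \<delta> * S k - (C + 19 / 24 * y * (S k)\<^sup>2 + 2 / (3 * y) * (S k) ^ 4))
        = - (\<delta> / real n * S k) - 1 / real n * (C + 19 / 24 * y * (S k)\<^sup>2 + 2 / (3 * y) * (S k) ^ 4)"
        unfolding right_diff_distrib by simp
      moreover have "\<rho> * S k = S k - \<delta> / real n * S k" by (simp add: left_diff_distrib)
      ultimately show "\<rho> * S k - 1 / real n * (C + 19 / 24 * y * (S k)\<^sup>2 + 2 / (3 * y) * (S k) ^ 4) \<le> P S k"
        unfolding step_magn_mean[OF k] by linarith
    qed
    finally show ?thesis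
      using mult_left_mono[OF E3, of "1 / real n"] unfolding mean_dist_Suc[OF n_pos] y_def by simp
  qed
  txt \<open>The correction telescopes: \<open>x\<^sub>j\<^sup>3/n\<close> is at most a multiple of \<open>x\<^sub>j (x\<^sub>j\<^sup>2 - x\<^sub>j\<^sub>+\<^sub>1\<^sup>2)/\<delta>\<close>.\<close>
  have claim: "x j - 68 / \<delta> * (x j * ((S k0)\<^sup>2 - (x j)\<^sup>2)) \<le> mean n (law k0 j) S" if "j \<le> t" for j
    using that
  proof (induction j)
    case 0
    then show ?case by (simp add: x_def mean_dist_0[OF k0])
  next
    case (Suc j)
    have "x t \<le> x j" unfolding x_def
      using Suc.prems s0 by (intro mult_right_mono power_decreasing rho_nonneg rho_le_1) auto
    then have "(x t)\<^sup>2 \<le> (x j)\<^sup>2" using x0[of t] by (intro power_mono) auto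
    then have "4 / (\<delta> * real n) \<le> (x j)\<^sup>2" using far by (simp add: x_def)
    from step[OF this] have st: "\<rho> * mean n (law k0 j) S - 34 / real n * x j ^ 3 \<le> mean n (law k0 (Suc j)) S" .
    \<comment> \<open>The constant doubles to 68 because \<rho> >= 1/2, while 1 - \<rho>^2 >=
      \<delta>/n supplies the factor that telescopes.\<close>
    have "34 / real n * x j ^ 3 \<le> 68 / \<delta> * (\<rho> * x j ^ 3 * (1 - \<rho>\<^sup>2))"
    proof -
      have "1 / 2 * (\<delta> / real n) \<le> \<rho> * (1 - \<rho>\<^sup>2)"
        using rho_bounds(1) one_minus_rho_square delta_pos by (intro mult_mono rho_nonneg) auto
      then have "68 / \<delta> * (x j ^ 3 * (1 / 2 * (\<delta> / real n))) \<le> 68 / \<delta> * (x j ^ 3 * (\<rho> * (1 - \<rho>\<^sup>2)))"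
        using delta_pos x0[of j] by (intro mult_left_mono) auto
      then show ?thesis using delta_pos by (simp add: mult_ac)
    qed
    moreover have "\<rho> * (x j - 68 / \<delta> * (x j * ((S k0)\<^sup>2 - (x j)\<^sup>2))) \<le> \<rho> * mean n (law k0 j) S"
      using Suc by (intro mult_left_mono rho_nonneg) auto
    moreover have "\<rho> * (x j - 68 / \<delta> * (x j * ((S k0)\<^sup>2 - (x j)\<^sup>2))) - 68 / \<delta> * (\<rho> * x j ^ 3 * (1 - \<rho>\<^sup>2))
      = x (Suc j) - 68 / \<delta> * (x (Suc j) * ((S k0)\<^sup>2 - (x (Suc j))\<^sup>2))"
    proof -
      define q a where "q = \<rho>" and "a = 68 / \<delta>"
      show ?thesis unfolding xSuc q_def[symmetric] a_def[symmetric]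
        by (simp add: power2_eq_square power3_eq_cube algebra_simps)
    qed
    ultimately show ?case using st by linarith
  qed
  have "68 / \<delta> * (x t * ((S k0)\<^sup>2 - (x t)\<^sup>2)) \<le> 68 / \<delta> * (x t * (\<delta> / 144))"
  proof (intro mult_left_mono)
    show "(S k0)\<^sup>2 - (x t)\<^sup>2 \<le> \<delta> / 144" using s0(2) zero_le_power2[of "x t"] by linarith
  qed (use x0[of t] delta_pos in auto)
  also have "\<dots> \<le> x t / 2" using delta_pos x0[of t] by simp
  finally show ?thesis using claim[of t] by (simp add: x_def)
qed

text \<open>The threshold x/4 lies at distance at least x/4 both from the mean of the law, which is
  at least x/2, and from 0. Chebyshev with second moments 4/(\<delta> n) bounds either error by
  64/(\<delta> n x^2).\<close>

lemma tv_lower: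
  assumes k0: "k0 \<le> n" and s0: "0 < S k0" "(S k0)\<^sup>2 \<le> \<delta> / 144"
    and far: "4 / (\<delta> * real n) \<le> (\<rho> ^ t * S k0)\<^sup>2"
  shows "1 - 128 / (\<delta> * real n * (\<rho> ^ t * S k0)\<^sup>2) \<le> tv_to_stat n \<beta> k0 t"
proof -
  define x m where "x = \<rho> ^ t * S k0" and "m = mean n (law k0 t) S"
  define f where "f k = (if x / 4 \<le> S k then 1 else - 1 :: real)" for k
  note p = prob_vec_dist[OF k0, of t]
  have x: "0 < x" using rho_pos s0 by (simp only: x_def mult_pos_pos zero_less_power)
  have m: "x / 2 \<le> m" using mean_magn_lower[OF assms] by (simp add: x_def m_def)
  have cheb: "4 / (\<delta> * real n) / (x / 4)\<^sup>2 = 64 / (\<delta> * real n * x\<^sup>2)"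
    by (simp add: power_divide)
  have "mean n (law k0 t) (\<lambda>k. 1 - 2 * (if x / 4 \<le> \<bar>S k - m\<bar> then 1 else 0)) \<le> mean n (law k0 t) f"
  proof (intro mean_mono p)
    fix k
    have "x / 4 \<le> S k \<or> x / 4 \<le> \<bar>S k - m\<bar>" using m by linarith
    then show "1 - 2 * (if x / 4 \<le> \<bar>S k - m\<bar> then 1 else 0) \<le> f k" by (auto simp: f_def)
  qed
  moreover have "mean n (law k0 t) (\<lambda>k. if x / 4 \<le> \<bar>S k - m\<bar> then 1 else 0) \<le> 4 / (\<delta> * real n) / (x / 4)\<^sup>2"
  proof (rule order_trans[OF chebyshev[OF p]])
    have "mean n (law k0 t) (\<lambda>k. (S k - m)\<^sup>2) \<le> 4 / (\<delta> * real n)"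
      using variance_bound[OF k0, of t] mean_variance[OF p, of S m] by (simp add: m_def power2_eq_square)
    then show "mean n (law k0 t) (\<lambda>k. (S k - m)\<^sup>2) / (x / 4)\<^sup>2 \<le> 4 / (\<delta> * real n) / (x / 4)\<^sup>2"
      by (intro divide_right_mono) auto
  qed (use x in simp)
  ultimately have 1: "1 - 128 / (\<delta> * real n * x\<^sup>2) \<le> mean n (law k0 t) f"
    unfolding mean_diff mean_cmult mean_const[OF p] cheb by simp
  have "mean n \<pi> f \<le> mean n \<pi> (\<lambda>k. 2 * (if x / 4 \<le> \<bar>S k - 0\<bar> then 1 else 0) - 1)"
    by (intro mean_mono prob_vec_pi) (auto simp: f_def)
  moreover have "mean n \<pi> (\<lambda>k. if x / 4 \<le> \<bar>S k - 0\<bar> then 1 else 0) \<le> 4 / (\<delta> * real n) / (x / 4)\<^sup>2"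
  proof (rule order_trans[OF chebyshev[OF prob_vec_pi]])
    show "mean n \<pi> (\<lambda>k. (S k - 0)\<^sup>2) / (x / 4)\<^sup>2 \<le> 4 / (\<delta> * real n) / (x / 4)\<^sup>2"
      using second_moment_pi by (intro divide_right_mono) auto
  qed (use x in simp)
  ultimately have 2: "mean n \<pi> f \<le> 128 / (\<delta> * real n * x\<^sup>2) - 1"
    unfolding mean_diff mean_cmult mean_const[OF prob_vec_pi] cheb by simp
  have "mean n (law k0 t) f - mean n \<pi> f \<le> 2 * tv_to_stat n \<beta> k0 t"
    by (rule tv_ge_test) (simp add: f_def)
  then show ?thesis using 1 2 unfolding x_def[symmetric] by simp
qed

text \<open>The target sqrt \<delta> / 24 is rounded up to the lattice. As \<delta> <= 1, the
  hypothesis gives sqrt \<delta> * n >= 384, so the spacing 2/n is far below sqrt \<delta> /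
  24.\<close>

lemma start_exists:
  assumes large: "384 \<le> \<delta>\<^sup>2 * real n"
  obtains k0 where "k0 \<le> n" "sqrt \<delta> / 24 \<le> S k0" "S k0 \<le> sqrt \<delta> / 12"
proof
  define r where "r = sqrt \<delta>"
  define k0 where "k0 = nat \<lceil>real n * (1 + r / 24) / 2\<rceil>"
  have r: "0 < r" "r \<le> 1" using delta_pos delta_le_1 by (auto simp: r_def)
  have "\<delta>\<^sup>2 = r ^ 4" using delta_pos by (simp add: r_def power4_eq_xxxx power2_eq_square)
  also have "r ^ 4 \<le> r ^ 1" using r by (intro power_decreasing) auto
  finally have "\<delta>\<^sup>2 * real n \<le> r * real n" by (intro mult_right_mono) auto
  then have rn: "384 \<le> r * real n" using large by linarith
  have "0 \<le> real n * (1 + r / 24) / 2" using r by simp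
  then have k: "real n * (1 + r / 24) / 2 \<le> real k0" "real k0 \<le> real n * (1 + r / 24) / 2 + 1"
    unfolding k0_def by linarith+
  have k': "real n + r * real n / 24 \<le> 2 * real k0" "2 * real k0 \<le> real n + r * real n / 24 + 2"
    using k by (simp_all add: field_simps)
  have "real k0 \<le> real n"
  proof -
    have "r * real n \<le> 1 * real n" using r by (intro mult_right_mono) auto
    then show ?thesis using k' rn by linarith
  qed
  then show "k0 \<le> n" by simp
  show "sqrt \<delta> / 24 \<le> S k0" "S k0 \<le> sqrt \<delta> / 12"
    unfolding r_def[symmetric] using k rn n_pos by (auto simp: magn_def field_simps)
qed

text \<open>Starting at order sqrt \<delta>, the linear trajectory still satisfies x^2 >=
  exp(2\<gamma> - 2)/(576 \<delta> n), and 73728 = 128 * 576. The condition on the logarithm makes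
  the time nonnegative.\<close>

lemma d_n_before_cutoff:
  assumes large: "384 \<le> \<delta>\<^sup>2 * real n" and \<gamma>: "6 \<le> \<gamma>" "2 * \<gamma> \<le> ln (\<delta>\<^sup>2 * real n)"
  shows "1 - 73728 * exp (2 - 2 * \<gamma>)
    \<le> d_n_real n \<beta> (1 / 2 * (real n / \<delta>) * ln (\<delta>\<^sup>2 * real n) - \<gamma> * (real n / \<delta>))"
proof -
  define z where "z = \<delta> / real n"
  define t where "t = nat \<lfloor>1 / 2 * (real n / \<delta>) * ln (\<delta>\<^sup>2 * real n) - \<gamma> * (real n / \<delta>)\<rfloor>"
  have z: "0 < z" "z \<le> 1 / 2" using delta_pos n_pos rho_bounds(1) by (auto simp: z_def)
  have "1 / 2 * (real n / \<delta>) * ln (\<delta>\<^sup>2 * real n) - \<gamma> * (real n / \<delta>) = (ln (\<delta>\<^sup>2 * real n) - 2 * \<gamma>) / (2 * z)"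
    using delta_pos n_pos by (simp add: z_def field_simps)
  moreover have "0 \<le> (ln (\<delta>\<^sup>2 * real n) - 2 * \<gamma>) / (2 * z)" using \<gamma> z by simp
  ultimately have "real t \<le> (ln (\<delta>\<^sup>2 * real n) - 2 * \<gamma>) / (2 * z)" unfolding t_def by linarith
  then have tz: "2 * (real t * z) \<le> ln (\<delta>\<^sup>2 * real n) - 2 * \<gamma>" using z by (simp add: field_simps)
  have ln_n: "ln (\<delta>\<^sup>2 * real n) \<le> real n"
  proof -
    have "\<delta>\<^sup>2 * real n \<le> 1 * real n" using delta_pos delta_le_1 by (intro mult_right_mono power_le_one) auto
    moreover have "ln (\<delta>\<^sup>2 * real n) \<le> \<delta>\<^sup>2 * real n - 1" using large by (intro ln_le_minus_one) auto
    ultimately show ?thesis by linarith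
  qed
  \<comment> \<open>The second-order error in ln(1 - z) >= -z - 2 z^2, summed over 2t factors, is at
    most 2; this is the 2 in exp(2\<gamma> - 2).\<close>
  have "2 * (real t * z) * (2 * z) \<le> real n * (2 * z)"
    using tz ln_n \<gamma> z by (intro mult_right_mono) auto
  also have "\<dots> \<le> 2" using n_pos delta_le_1 by (simp add: z_def)
  finally have tzz: "2 * (real t * z) * (2 * z) \<le> 2" .
  have "- z - 2 * z\<^sup>2 \<le> ln (1 - z)" using z by (intro ln_one_minus_pos_lower_bound) auto
  then have "(2 * real t) * (- z - 2 * z\<^sup>2) \<le> (2 * real t) * ln (1 - z)" by (intro mult_left_mono) auto
  moreover have "(2 * real t) * (- z - 2 * z\<^sup>2) = - (2 * (real t * z)) - 2 * (real t * z) * (2 * z)"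
    by (simp add: power2_eq_square algebra_simps)
  ultimately have "2 * \<gamma> - 2 - ln (\<delta>\<^sup>2 * real n) \<le> (2 * real t) * ln (1 - z)" using tz tzz by linarith
  then have "exp (2 * \<gamma> - 2 - ln (\<delta>\<^sup>2 * real n)) \<le> exp ((2 * real t) * ln (1 - z))" by simp
  also have "\<dots> = \<rho> ^ (2 * t)"
    using z exp_of_nat_mult[of "2 * t" "ln (1 - z)"] by (simp add: z_def[symmetric])
  finally have \<rho>t: "exp (2 * \<gamma> - 2) / (\<delta>\<^sup>2 * real n) \<le> (\<rho> ^ t)\<^sup>2"
    using large by (simp add: exp_diff power_mult[symmetric] mult.commute)
  obtain k0 where k0: "k0 \<le> n" "sqrt \<delta> / 24 \<le> S k0" "S k0 \<le> sqrt \<delta> / 12"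
    using start_exists[OF large] by blast
  have "0 < sqrt \<delta> / 24" using delta_pos by simp
  then have s0: "0 < S k0" using k0 by linarith
  have "(S k0)\<^sup>2 \<le> (sqrt \<delta> / 12)\<^sup>2" using k0 s0 by (intro power_mono) auto
  then have s0': "(S k0)\<^sup>2 \<le> \<delta> / 144" using delta_pos by (simp add: power_divide)
  have "(sqrt \<delta> / 24)\<^sup>2 \<le> (S k0)\<^sup>2" using k0 delta_pos by (intro power_mono) auto
  then have s0'': "\<delta> / 576 \<le> (S k0)\<^sup>2" using delta_pos by (simp add: power_divide)
  have "exp (2 * \<gamma> - 2) / (\<delta>\<^sup>2 * real n) * (\<delta> / 576) \<le> (\<rho> ^ t)\<^sup>2 * (S k0)\<^sup>2"
    using delta_pos by (intro mult_mono \<rho>t s0'') auto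
  then have x: "exp (2 * \<gamma> - 2) / 576 / (\<delta> * real n) \<le> (\<rho> ^ t * S k0)\<^sup>2"
    unfolding power_mult_distrib using delta_pos by (simp add: power2_eq_square[of \<delta>] mult_ac)
  \<comment> \<open>Requires exp(2\<gamma> - 2) >= 4 * 576 = 2304. For \<gamma> >= 6 the exponent is
    at least 10, and (1 + 10/20)^20 already exceeds this.\<close>
  have far: "4 / (\<delta> * real n) \<le> (\<rho> ^ t * S k0)\<^sup>2"
  proof (rule order_trans[OF _ x], rule divide_right_mono)
    have "(1 + (2 * \<gamma> - 2) / 20) ^ 20 \<le> exp (2 * \<gamma> - 2)"
      using exp_ge_one_plus_x_over_n_power_n[of 20 "2 * \<gamma> - 2"] \<gamma> by simp
    moreover have "(3 / 2) ^ 20 \<le> (1 + (2 * \<gamma> - 2) / 20) ^ 20" using \<gamma> by (intro power_mono) auto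
    moreover have "2304 \<le> (3 / 2 :: real) ^ 20" by (simp add: power_divide)
    ultimately show "4 \<le> exp (2 * \<gamma> - 2) / 576" by linarith
  qed (use delta_n_pos in simp)
  have "1 - 73728 * exp (2 - 2 * \<gamma>) \<le> 1 - 128 / (\<delta> * real n * (\<rho> ^ t * S k0)\<^sup>2)"
  proof -
    have "exp (2 * \<gamma> - 2) / 576 \<le> \<delta> * real n * (\<rho> ^ t * S k0)\<^sup>2"
      using x delta_n_pos by (simp add: field_simps)
    then have "128 / (\<delta> * real n * (\<rho> ^ t * S k0)\<^sup>2) \<le> 128 / (exp (2 * \<gamma> - 2) / 576)"
      by (intro frac_le) auto
    also have "\<dots> = 73728 * exp (- (2 * \<gamma> - 2))" by (simp add: exp_minus field_simps del: minus_diff_eq)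
    finally show ?thesis by simp
  qed
  also have "\<dots> \<le> tv_to_stat n \<beta> k0 t" by (rule tv_lower[OF k0(1) s0 s0' far])
  also have "\<dots> \<le> d_n n \<beta> t" unfolding d_n_def using k0 by (intro Max_ge) auto
  finally show ?thesis by (simp add: d_n_real_def t_def)
qed

lemma d_n_bounds: "0 \<le> d_n n \<beta> t" "d_n n \<beta> t \<le> 1"
proof -
  have "d_n n \<beta> t \<in> (\<lambda>k0. tv_to_stat n \<beta> k0 t) ` {0..n}"
    unfolding d_n_def by (rule Max_in) auto
  then obtain k0 where k0: "k0 \<le> n" "d_n n \<beta> t = tv_to_stat n \<beta> k0 t" by auto
  show "0 \<le> d_n n \<beta> t" unfolding k0 by (simp add: tv_to_stat_def sum_nonneg)
  obtain f where f: "\<And>k. \<bar>f k\<bar> \<le> 1"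
    and tv: "2 * tv_to_stat n \<beta> k0 t = mean n (law k0 t) f - mean n \<pi> f"
    using tv_eq_test[of n \<beta> k0 t] by blast
  have f': "f k \<le> 1" "- 1 \<le> f k" for k using f[of k] by auto
  have "mean n (law k0 t) f \<le> mean n (law k0 t) (\<lambda>_. 1)" "mean n \<pi> (\<lambda>_. - 1) \<le> mean n \<pi> f"
    by (intro mean_mono prob_vec_dist prob_vec_pi k0 f')+
  then have "mean n (law k0 t) f \<le> 1" "- 1 \<le> mean n \<pi> f"
    using mean_const[OF prob_vec_dist[OF k0(1), of t]] mean_const[OF prob_vec_pi[of n \<beta>]] by auto
  then show "d_n n \<beta> t \<le> 1" unfolding k0 using tv by linarith
qed

end

section \<open>Passage to the limits in n and \<gamma>\<close>

theorem theorem4p1: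
  fixes \<delta> :: "nat \<Rightarrow> real"
  assumes pos: "\<And>n. \<delta> n > 0"
    and le1: "\<And>n. \<delta> n \<le> 1"
    and lim: "filterlim (\<lambda>n. (\<delta> n)\<^sup>2 * real n) at_top sequentially"
  shows "((\<lambda>\<gamma>. limsup (\<lambda>n. ereal (d_n_real n (1 - \<delta> n)
            (1/2 * (real n / \<delta> n) * ln ((\<delta> n)\<^sup>2 * real n) + \<gamma> * (real n / \<delta> n)))))
           \<longlongrightarrow> 0) at_top \<and>
         ((\<lambda>\<gamma>. liminf (\<lambda>n. ereal (d_n_real n (1 - \<delta> n)
            (1/2 * (real n / \<delta> n) * ln ((\<delta> n)\<^sup>2 * real n) - \<gamma> * (real n / \<delta> n)))))
           \<longlongrightarrow> 1) at_top"
    (is "(?up \<longlongrightarrow> 0) at_top \<and> (?lo \<longlongrightarrow> 1) at_top")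
proof
  have sub: "subcritical n (\<delta> n)" if "2 \<le> n" for n
    using that pos le1 by unfold_locales auto
  have large: "\<forall>\<^sub>F n in sequentially. C \<le> (\<delta> n)\<^sup>2 * real n" for C
    using lim by (simp add: filterlim_at_top)
  have ge0: "\<forall>\<^sub>F n in sequentially. 0 \<le> ereal (d_n_real n (1 - \<delta> n) (r n))"
    and le_1: "\<forall>\<^sub>F n in sequentially. ereal (d_n_real n (1 - \<delta> n) (r n)) \<le> 1" for r
    by (rule eventually_mono[OF eventually_ge_at_top[of 2]];
        simp add: d_n_real_def subcritical.d_n_bounds sub)+
  show "(?up \<longlongrightarrow> 0) at_top"
  proof (rule tendsto_sandwich)
    show "\<forall>\<^sub>F \<gamma> in at_top. 0 \<le> ?up \<gamma>"
      by (intro always_eventually allI le_Limsup ge0) simp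
    show "\<forall>\<^sub>F \<gamma> in at_top. ?up \<gamma> \<le> ereal (sqrt (577 / (\<gamma> - 98)))"
      using eventually_ge_at_top[of "100 :: real"]
    proof eventually_elim
      fix \<gamma> :: real assume \<gamma>: "100 \<le> \<gamma>"
      show "?up \<gamma> \<le> ereal (sqrt (577 / (\<gamma> - 98)))"
      proof (rule Limsup_bounded)
        show "\<forall>\<^sub>F n in sequentially. ereal (d_n_real n (1 - \<delta> n)
            (1/2 * (real n / \<delta> n) * ln ((\<delta> n)\<^sup>2 * real n) + \<gamma> * (real n / \<delta> n))) \<le> ereal (sqrt (577 / (\<gamma> - 98)))"
          \<comment> \<open>The second threshold makes the lattice error 884736/(\<delta> n) at most
            1/(\<gamma> - 98), which turns 576 into 577.\<close>
          using large[of 384] large[of "884736 * (\<gamma> - 98)"] eventually_ge_at_top[of 2]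
        proof eventually_elim
          case (elim n)
          interpret subcritical n "\<delta> n" by (rule sub) fact
          have "(\<delta> n)\<^sup>2 * real n \<le> \<delta> n * real n"
            using pos[of n] le1[of n] by (intro mult_right_mono) (auto simp: power2_eq_square mult_left_le)
          then have dn: "884736 * (\<gamma> - 98) \<le> \<delta> n * real n" using elim by linarith
          have "884736 / (\<delta> n * real n) \<le> 1 / (\<gamma> - 98)"
            using dn \<gamma> delta_n_pos by (simp add: field_simps)
          then have "576 / (\<gamma> - 98) + 884736 / (\<delta> n * real n) \<le> 577 / (\<gamma> - 98)"
            using add_divide_distrib[of 576 1 "\<gamma> - 98"] by simp
          then show ?case using d_n_after_cutoff[OF elim(1) \<gamma>] by (simp add: real_le_rsqrt)
        qed
      qed
    qed
    have "((\<lambda>\<gamma>::real. sqrt (577 / (\<gamma> - 98))) \<longlongrightarrow> sqrt 0) at_top"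
      using filterlim_tendsto_add_at_top[OF tendsto_const[of "- 98"] filterlim_ident]
      by (intro tendsto_real_sqrt tendsto_divide_0[OF tendsto_const] filterlim_at_top_imp_at_infinity) simp
    then show "((\<lambda>\<gamma>. ereal (sqrt (577 / (\<gamma> - 98)))) \<longlongrightarrow> 0) at_top"
      by (simp add: zero_ereal_def)
  qed simp
  show "(?lo \<longlongrightarrow> 1) at_top"
  proof (rule tendsto_sandwich)
    show "\<forall>\<^sub>F \<gamma> in at_top. ereal (1 - 73728 * exp (2 - 2 * \<gamma>)) \<le> ?lo \<gamma>"
      using eventually_ge_at_top[of "6 :: real"]
    proof eventually_elim
      fix \<gamma> :: real assume \<gamma>: "6 \<le> \<gamma>"
      show "ereal (1 - 73728 * exp (2 - 2 * \<gamma>)) \<le> ?lo \<gamma>"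
      proof (rule Liminf_bounded)
        show "\<forall>\<^sub>F n in sequentially. ereal (1 - 73728 * exp (2 - 2 * \<gamma>)) \<le> ereal (d_n_real n (1 - \<delta> n)
            (1/2 * (real n / \<delta> n) * ln ((\<delta> n)\<^sup>2 * real n) - \<gamma> * (real n / \<delta> n)))"
          \<comment> \<open>For fixed \<gamma>, eventually \<delta>^2 n >= exp(2\<gamma>), which is
            the logarithmic condition of the lower bound.\<close>
          using large[of 384] large[of "exp (2 * \<gamma>)"] eventually_ge_at_top[of 2]
        proof eventually_elim
          case (elim n)
          interpret subcritical n "\<delta> n" by (rule sub) fact
          have "2 * \<gamma> \<le> ln ((\<delta> n)\<^sup>2 * real n)" using elim by (subst ln_ge_iff) auto
          from d_n_before_cutoff[OF elim(1) \<gamma> this] show ?case by simp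
        qed
      qed
    qed
    show "\<forall>\<^sub>F \<gamma> in at_top. ?lo \<gamma> \<le> 1"
      by (intro always_eventually allI Liminf_le le_1) simp
    have "((\<lambda>\<gamma>::real. exp (- \<gamma>)) \<longlongrightarrow> 0) at_top"
      by (rule filterlim_compose[OF exp_at_bot filterlim_uminus_at_bot_at_top])
    then have "((\<lambda>\<gamma>::real. 1 - 73728 * (exp 2 * (exp (- \<gamma>))\<^sup>2)) \<longlongrightarrow> 1 - 73728 * (exp 2 * 0\<^sup>2)) at_top"
      by (intro tendsto_intros)
    moreover have "exp 2 * (exp (- \<gamma>))\<^sup>2 = exp (2 - 2 * \<gamma>)" for \<gamma> :: real
      by (simp add: power2_eq_square flip: exp_add)
    ultimately have "((\<lambda>\<gamma>::real. 1 - 73728 * exp (2 - 2 * \<gamma>)) \<longlongrightarrow> 1) at_top" by simp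
    then show "((\<lambda>\<gamma>. ereal (1 - 73728 * exp (2 - 2 * \<gamma>))) \<longlongrightarrow> 1) at_top"
      by (simp add: one_ereal_def)
  qed simp
qed

end
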